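(* Let $K \in \{\mathbb{R}, \mathbb{C}, \mathbb{H}\}$, and let $n_K = 3$ if $K = \mathbb{R}$ and $n_K = 2$ if $K = \mathbb{C}$ or $K=\mathbb{H}$. Then for every integer $n \geq n_K$, the $(n-1)$-dimensional $K$-projective space $KP^{n-1}$ is $G(n,K)$-paradoxical.
   Context: $\mathbb{H}$ denotes the quaternion algebra. For $K = \mathbb{R}, \mathbb{C}, \mathbb{H}$, $K^n$ is regarded as an $n$-dimensional right $K$-vector space with inner product $(x,y) := \bar{x}_1 y_1 + \cdots + \bar{x}_n y_n$ for $x,y\in K^n$ and metric $d(x,y) := \sqrt{(x-y,x-y)}$. $G(n,K)$ denotes the group of $K$-linear isometries of $K^n$, i.e. $O(n)$, $U(n)$, $Sp(n)$ for $K = \mathbb{R}, \mathbb{C}, \mathbb{H}$ respectively (acting on column vectors by left matrix multiplication). $KP^{n-1}$ is the set of all lines through the origin (1-dimensional right $K$-subspaces) in $K^n$, on which $G(n,K)$ acts by $g\cdot \ell = g\ell$. Let a group $G$ act on a non-empty set $X$. Non-empty subsets $A, B \subset X$ are called $G$-equidecomposable if there exist finitely many elements $g_1, \ldots, g_m \in G$ and partitions $A = \bigsqcup_{i=1}^m A_i$, $B = \bigsqcup_{i=1}^m B_i$ such that $A_i = g_i B_i$ for all $i$. A non-empty subset $E \subset X$ is called $G$-paradoxical if there exist disjoint subsets $A, B \subset E$ such that $A$ is $G$-equidecomposable to $E$ and $B$ is $G$-equidecomposable to $E$. (Here $E$ is the whole set $X$.) *)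

theory Defs
  imports "HOL-Analysis.Analysis" "HOL-Algebra.Group_Action"
begin

text \<open>
  A common setting for the real numbers, the complex numbers and the quaternions, so that the
  inner product, the isometry group and the projective space are defined once for all three.
\<close>

class conj_div_algebra = real_div_algebra +
  fixes kconj :: "'a \<Rightarrow> 'a" and kre :: "'a \<Rightarrow> real"
  assumes kconj_add: "kconj (x + y) = kconj x + kconj y"
    and kconj_mult: "kconj (x * y) = kconj y * kconj x"
    and kconj_kconj: "kconj (kconj x) = x"
    and add_kconj: "x + kconj x = (2 * kre x) *\<^sub>R 1"
    and kconj_mult_self: "kconj x * x = kre (kconj x * x) *\<^sub>R 1"
    and kre_kconj_mult_self_pos: "x \<noteq> 0 \<Longrightarrow> 0 < kre (kconj x * x)"

instantiation real :: conj_div_algebra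
begin
definition kconj_real :: "real \<Rightarrow> real" where "kconj_real x = x"
definition kre_real :: "real \<Rightarrow> real" where "kre_real x = x"
instance
  by standard (auto simp: kconj_real_def kre_real_def zero_less_mult_iff)
end

instantiation complex :: conj_div_algebra
begin
definition kconj_complex :: "complex \<Rightarrow> complex" where "kconj_complex = cnj"
definition kre_complex :: "complex \<Rightarrow> real" where "kre_complex = Re"
instance
  by standard
    (auto simp: kconj_complex_def kre_complex_def complex_eq_iff zero_less_mult_iff
      sum_squares_gt_zero_iff)
end

text \<open>\<open>Quat a b c d\<close> stands for \<open>a + b i + c j + d k\<close>.\<close>

datatype quat = Quat (qre: real) (qi: real) (qj: real) (qk: real)

lemma quat_eq_iff:
  "x = y \<longleftrightarrow> qre x = qre y \<and> qi x = qi y \<and> qj x = qj y \<and> qk x = qk y"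
  by (cases x; cases y) auto

definition qnorm2 :: "quat \<Rightarrow> real"
  where "qnorm2 x = (qre x)\<^sup>2 + (qi x)\<^sup>2 + (qj x)\<^sup>2 + (qk x)\<^sup>2"

lemma qnorm2_pos: "x \<noteq> Quat 0 0 0 0 \<Longrightarrow> 0 < qnorm2 x"
  unfolding quat_eq_iff qnorm2_def quat.sel
  by (smt (verit) zero_less_power2 zero_le_power2)

instantiation quat :: conj_div_algebra
begin

definition zero_quat :: quat where "0 = Quat 0 0 0 0"

definition one_quat :: quat where "1 = Quat 1 0 0 0"

definition plus_quat :: "quat \<Rightarrow> quat \<Rightarrow> quat"
  where "x + y = Quat (qre x + qre y) (qi x + qi y) (qj x + qj y) (qk x + qk y)"

definition uminus_quat :: "quat \<Rightarrow> quat"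
  where "- x = Quat (- qre x) (- qi x) (- qj x) (- qk x)"

definition minus_quat :: "quat \<Rightarrow> quat \<Rightarrow> quat"
  where "x - y = Quat (qre x - qre y) (qi x - qi y) (qj x - qj y) (qk x - qk y)"

definition scaleR_quat :: "real \<Rightarrow> quat \<Rightarrow> quat"
  where "r *\<^sub>R x = Quat (r * qre x) (r * qi x) (r * qj x) (r * qk x)"

definition times_quat :: "quat \<Rightarrow> quat \<Rightarrow> quat"
  where "x * y = Quat
    (qre x * qre y - qi x * qi y - qj x * qj y - qk x * qk y)
    (qre x * qi y + qi x * qre y + qj x * qk y - qk x * qj y)
    (qre x * qj y - qi x * qk y + qj x * qre y + qk x * qi y)
    (qre x * qk y + qi x * qj y - qj x * qi y + qk x * qre y)"

definition kconj_quat :: "quat \<Rightarrow> quat"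
  where "kconj x = Quat (qre x) (- qi x) (- qj x) (- qk x)"

definition kre_quat :: "quat \<Rightarrow> real"
  where "kre_quat = qre"

definition inverse_quat :: "quat \<Rightarrow> quat"
  where "inverse x = (1 / qnorm2 x) *\<^sub>R kconj x"

definition divide_quat :: "quat \<Rightarrow> quat \<Rightarrow> quat"
  where "x div y = x * inverse (y::quat)"

lemmas quat_defs = zero_quat_def one_quat_def plus_quat_def uminus_quat_def minus_quat_def
  scaleR_quat_def times_quat_def kconj_quat_def kre_quat_def

instance
proof
  fix x y z :: quat and a b :: real
  show "x + y + z = x + (y + z)" "x + y = y + x" "0 + x = x" "- x + x = 0" "x - y = x + - y"
    "a *\<^sub>R (x + y) = a *\<^sub>R x + a *\<^sub>R y" "(a + b) *\<^sub>R x = a *\<^sub>R x + b *\<^sub>R x"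
    "a *\<^sub>R b *\<^sub>R x = (a * b) *\<^sub>R x" "1 *\<^sub>R x = x" "x * y * z = x * (y * z)"
    "1 * x = x" "x * 1 = x" "(x + y) * z = x * z + y * z" "x * (y + z) = x * y + x * z"
    "(0::quat) \<noteq> 1" "a *\<^sub>R x * y = a *\<^sub>R (x * y)" "x * a *\<^sub>R y = a *\<^sub>R (x * y)"
    by (simp_all add: quat_defs quat_eq_iff algebra_simps)
  show "x \<noteq> 0 \<Longrightarrow> inverse x * x = 1" "x \<noteq> 0 \<Longrightarrow> x * inverse x = 1"
    using qnorm2_pos[of x]
    by (auto simp: inverse_quat_def quat_defs quat_eq_iff field_simps,
        auto simp: qnorm2_def power2_eq_square)
  show "x div y = x * inverse y" by (rule divide_quat_def)
  show "inverse (0::quat) = 0"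
    by (simp add: inverse_quat_def quat_defs)
  show "kconj (x + y) = kconj x + kconj y" "kconj (x * y) = kconj y * kconj x"
    "kconj (kconj x) = x" "x + kconj x = (2 * kre x) *\<^sub>R 1"
    "kconj x * x = kre (kconj x * x) *\<^sub>R 1"
    by (simp_all add: quat_defs quat_eq_iff algebra_simps)
  have "kre (kconj x * x) = qnorm2 x"
    by (simp add: quat_defs qnorm2_def power2_eq_square)
  then show "x \<noteq> 0 \<Longrightarrow> 0 < kre (kconj x * x)"
    using qnorm2_pos[of x] by (simp add: zero_quat_def)
qed

end

lemma quat_units:
  defines "i \<equiv> Quat 0 1 0 0" and "j \<equiv> Quat 0 0 1 0" and "k \<equiv> Quat 0 0 0 1"
  shows "i * i = -1" "j * j = -1" "k * k = -1" "i * j = k" "j * k = i" "k * i = j"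
    "Quat a b c d = a *\<^sub>R 1 + b *\<^sub>R i + c *\<^sub>R j + d *\<^sub>R k"
  by (simp_all add: i_def j_def k_def quat_defs quat_eq_iff)

definition rscale :: "'k::conj_div_algebra ^ 'n \<Rightarrow> 'k \<Rightarrow> 'k ^ 'n"  (infixl \<open>\<cdot>\<^sub>r\<close> 75)
  where "v \<cdot>\<^sub>r c = (\<chi> i. v $ i * c)"

definition kinner :: "'k::conj_div_algebra ^ 'n \<Rightarrow> 'k ^ 'n \<Rightarrow> 'k"
  where "kinner x y = (\<Sum>i\<in>UNIV. kconj (x $ i) * y $ i)"

text \<open>\<open>kinner v v\<close> is a nonnegative real multiple of \<open>1\<close>; \<open>kre\<close> extracts that real number.\<close>

definition kdist :: "'k::conj_div_algebra ^ 'n \<Rightarrow> 'k ^ 'n \<Rightarrow> real"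
  where "kdist x y = sqrt (kre (kinner (x - y) (x - y)))"

definition right_linear :: "('k::conj_div_algebra ^ 'n \<Rightarrow> 'k ^ 'n) \<Rightarrow> bool"
  where "right_linear f \<longleftrightarrow>
    (\<forall>x y. f (x + y) = f x + f y) \<and> (\<forall>x c. f (x \<cdot>\<^sub>r c) = f x \<cdot>\<^sub>r c)"

definition isometry_group :: "('k::conj_div_algebra ^ 'n \<Rightarrow> 'k ^ 'n) monoid"
  where "isometry_group =
    \<lparr>carrier = {f. right_linear f \<and> bij f \<and> (\<forall>x y. kdist (f x) (f y) = kdist x y)},
     monoid.mult = (\<circ>), one = id\<rparr>"

definition right_line :: "'k::conj_div_algebra ^ 'n \<Rightarrow> ('k ^ 'n) set"
  where "right_line v = range (\<lambda>c. v \<cdot>\<^sub>r c)"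

definition projective_space :: "('k::conj_div_algebra ^ 'n) set set"
  where "projective_space = right_line ` {v. v \<noteq> 0}"

text \<open>Group actions in the library are extensional, hence the restriction.\<close>

definition line_action ::
  "('k::conj_div_algebra ^ 'n \<Rightarrow> 'k ^ 'n) \<Rightarrow> ('k ^ 'n) set \<Rightarrow> ('k ^ 'n) set"
  where "line_action g = restrict (image g) projective_space"

definition equidecomposable ::
  "('g, 'b) monoid_scheme \<Rightarrow> 'x set \<Rightarrow> ('g \<Rightarrow> 'x \<Rightarrow> 'x) \<Rightarrow> 'x set \<Rightarrow> 'x set \<Rightarrow> bool"
  where "equidecomposable G X \<phi> A B \<longleftrightarrow>
    A \<noteq> {} \<and> B \<noteq> {} \<and> A \<subseteq> X \<and> B \<subseteq> X \<and>
    (\<exists>(m::nat) g P Q.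
      (\<forall>i<m. g i \<in> carrier G) \<and>
      disjoint_family_on P {..<m} \<and> (\<Union>i<m. P i) = A \<and>
      disjoint_family_on Q {..<m} \<and> (\<Union>i<m. Q i) = B \<and>
      (\<forall>i<m. P i = \<phi> (g i) ` Q i))"

definition paradoxical ::
  "('g, 'b) monoid_scheme \<Rightarrow> 'x set \<Rightarrow> ('g \<Rightarrow> 'x \<Rightarrow> 'x) \<Rightarrow> 'x set \<Rightarrow> bool"
  where "paradoxical G X \<phi> E \<longleftrightarrow>
    E \<noteq> {} \<and> E \<subseteq> X \<and>
    (\<exists>A B. A \<subseteq> E \<and> B \<subseteq> E \<and> A \<inter> B = {} \<and>
      equidecomposable G X \<phi> A E \<and> equidecomposable G X \<phi> B E)"

lemma kdist_real: "kdist x y = dist x (y :: real ^ 'n)"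
  by (simp add: kdist_def kinner_def kconj_real_def kre_real_def dist_norm norm_vec_def
      L2_set_def power2_eq_square)

lemma kdist_complex: "kdist x y = dist x (y :: complex ^ 'n)"
  by (simp add: kdist_def kinner_def kconj_complex_def kre_complex_def dist_norm norm_vec_def
      L2_set_def cmod_power2)
    (simp add: power2_eq_square algebra_simps)

lemma group_isometry_group:
  "group (isometry_group :: ('k::conj_div_algebra ^ 'n \<Rightarrow> 'k ^ 'n) monoid)"
proof (rule groupI)
  fix f :: "'k ^ 'n \<Rightarrow> 'k ^ 'n"
  assume f: "f \<in> carrier isometry_group"
  then have b: "bij f" and l: "right_linear f" and d: "\<And>x y. kdist (f x) (f y) = kdist x y"
    by (auto simp: isometry_group_def)
  have fi: "f (inv_into UNIV f x) = x" for x
    using b by (simp add: bij_is_surj surj_f_inv_f)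
  have if': "inv_into UNIV f (f x) = x" for x
    using b by (simp add: bij_is_inj inv_f_f)
  have "right_linear (inv_into UNIV f)"
    unfolding right_linear_def
  proof (intro conjI allI)
    fix x y
    have "x + y = f (inv_into UNIV f x + inv_into UNIV f y)"
      using l by (simp add: right_linear_def fi)
    then show "inv_into UNIV f (x + y) = inv_into UNIV f x + inv_into UNIV f y"
      using if' by simp
  next
    fix x c
    have "x \<cdot>\<^sub>r c = f (inv_into UNIV f x \<cdot>\<^sub>r c)"
      using l by (simp add: right_linear_def fi)
    then show "inv_into UNIV f (x \<cdot>\<^sub>r c) = inv_into UNIV f x \<cdot>\<^sub>r c"
      using if' by simp
  qed
  moreover have "kdist (inv_into UNIV f x) (inv_into UNIV f y) = kdist x y" for x y
    using d[of "inv_into UNIV f x" "inv_into UNIV f y"] by (simp add: fi)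
  ultimately have "inv_into UNIV f \<in> carrier isometry_group"
    using b by (simp add: isometry_group_def bij_imp_bij_inv)
  moreover have "inv_into UNIV f \<circ> f = id"
    using if' by auto
  ultimately show "\<exists>h\<in>carrier isometry_group.
      h \<otimes>\<^bsub>isometry_group\<^esub> f = \<one>\<^bsub>isometry_group\<^esub>"
    by (auto simp: isometry_group_def)
qed (auto simp: isometry_group_def right_linear_def intro: bij_comp)

lemma image_right_line: "right_linear f \<Longrightarrow> f ` right_line v = right_line (f v)"
  by (auto simp: right_line_def right_linear_def image_iff)

lemma isometry_image_projective_space:
  assumes "f \<in> carrier isometry_group"
  shows "image f ` projective_space = projective_space"
proof -
  have b: "bij f" and l: "right_linear f"
    using assms by (auto simp: isometry_group_def)
  have "f 0 + f 0 = f 0"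
    using l by (metis right_linear_def add_0)
  then have "f 0 = 0"
    by simp
  then have "f ` {v. v \<noteq> 0} = {v. v \<noteq> 0}"
    using b by (auto simp: image_iff bij_def inj_def)
  then show ?thesis
    unfolding projective_space_def image_image image_right_line[OF l]
    by (metis image_image)
qed

lemma group_action_line_action:
  "group_action (isometry_group :: ('k::conj_div_algebra ^ 'n \<Rightarrow> 'k ^ 'n) monoid)
    projective_space line_action"
proof -
  have B: "line_action f \<in> Bij projective_space" if "f \<in> carrier isometry_group"
    for f :: "'k ^ 'n \<Rightarrow> 'k ^ 'n"
  proof -
    have "inj (image f)"
      using that by (simp add: isometry_group_def bij_def inj_image_eq_iff inj_def)
    then show ?thesis
      using isometry_image_projective_space[OF that]
      by (auto simp: Bij_def line_action_def bij_betw_def intro: inj_on_subset)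
  qed
  have "line_action (f \<circ> g) = compose projective_space (line_action f) (line_action g)"
    if "g \<in> carrier isometry_group" for f g :: "'k ^ 'n \<Rightarrow> 'k ^ 'n"
    using isometry_image_projective_space[OF that]
    by (auto simp: line_action_def compose_def restrict_def fun_eq_iff image_comp)
  then have "line_action \<in> hom (isometry_group :: ('k ^ 'n \<Rightarrow> 'k ^ 'n) monoid)
      (BijGroup projective_space)"
    using B by (auto simp: hom_def BijGroup_def isometry_group_def)
  then show ?thesis
    by (simp add: group_action_def group_hom_def group_hom_axioms_def group_isometry_group
        group_BijGroup)
qed

end

theory Submission
  imports Defs "HOL-Computational_Algebra.Primes"
begin

text \<open>
  The unit quaternions act on \<open>K\<^sup>n\<close>, compatibly with rotating the pure quaternions \<open>Im \<H>\<close>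
  by conjugation: on three real coordinates seen as a pure quaternion, on two complex coordinates
  seen as a quaternion, and on all quaternionic coordinates at once. In each case a quadratic or
  linear equivariant map \<open>\<tau> : K\<^sup>n \<rightarrow> Im \<H>\<close> sends right lines to real lines or to \<open>0\<close>.

  The quaternions \<open>(1 + 2i)/\<surd>5\<close> and \<open>(1 + 2j)/\<surd>5\<close> generate a free group: modulo \<open>5\<close>, the
  product along a nonempty reduced word of \<open>1 \<plusminus> 2i\<close>, \<open>1 \<plusminus> 2j\<close> is nonzero although its norm is a
  power of \<open>5\<close>, so it is not real; modulo \<open>2\<close> it is \<open>1\<close>, so its real part is nonzero. Hence the
  only line of \<open>Im \<H>\<close> fixed by the word is its axis, which is spanned by an integer vector. The group
  therefore acts freely on the set \<open>A\<close> of lines \<open>\<ell>\<close> for which \<open>\<tau>(\<ell>)\<close> has no integer direction.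

  By freeness there are two piecewise translations embedding \<open>A\<close> into disjoint parts of itself.
  Finitely many isometries carry every line of \<open>K\<^sup>n\<close> into \<open>A\<close>: coordinate permutations and a few
  others make \<open>\<tau>\<close> nonzero, and a rotation involving \<open>\<surd>2\<close> destroys rationality. So the whole space
  embeds piecewise into \<open>A\<close>, and then twice, disjointly, into itself. No absorption of the
  exceptional lines is needed, because the two disjoint parts need not exhaust the space.
\<close>

section \<open>Paradoxes from piecewise translations\<close>

text \<open>No partition is recorded: \<open>equidecomposable_image\<close> recovers the pieces from
  the finite set of group elements.\<close>

definition piecewise ::
  "('g, 'b) monoid_scheme \<Rightarrow> ('g \<Rightarrow> 'x \<Rightarrow> 'x) \<Rightarrow> 'x set \<Rightarrow> ('x \<Rightarrow> 'x) \<Rightarrow> bool"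
  where "piecewise G \<phi> A f \<longleftrightarrow>
    (\<exists>S. finite S \<and> S \<subseteq> carrier G \<and> (\<forall>x\<in>A. \<exists>g\<in>S. f x = \<phi> g x))"

lemma piecewise_translation: "g \<in> carrier G \<Longrightarrow> piecewise G \<phi> A (\<phi> g)"
  unfolding piecewise_def by (rule exI[of _ "{g}"]) simp

lemma piecewise_If:
  assumes "piecewise G \<phi> {x\<in>A. P x} f" "piecewise G \<phi> {x\<in>A. \<not> P x} h"
  shows "piecewise G \<phi> A (\<lambda>x. if P x then f x else h x)"
proof -
  obtain S T where "finite S" "S \<subseteq> carrier G" "\<forall>x\<in>{x\<in>A. P x}. \<exists>g\<in>S. f x = \<phi> g x"
    "finite T" "T \<subseteq> carrier G" "\<forall>x\<in>{x\<in>A. \<not> P x}. \<exists>g\<in>T. h x = \<phi> g x"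
    using assms unfolding piecewise_def by blast
  then show ?thesis
    unfolding piecewise_def by (intro exI[of _ "S \<union> T"]) auto
qed

lemma (in group_action) piecewise_comp:
  assumes f: "piecewise G \<phi> A f" and h: "piecewise G \<phi> B h" and "f ` A \<subseteq> B" "A \<subseteq> E"
  shows "piecewise G \<phi> A (h \<circ> f)"
proof -
  obtain S T where S: "finite S" "S \<subseteq> carrier G" "\<forall>x\<in>A. \<exists>g\<in>S. f x = \<phi> g x"
    and T: "finite T" "T \<subseteq> carrier G" "\<forall>x\<in>B. \<exists>g\<in>T. h x = \<phi> g x"
    using f h unfolding piecewise_def by blast
  interpret group G
    using group_hom by (simp add: group_hom_def)
  show ?thesis
    unfolding piecewise_def
  proof (intro exI[of _ "(\<lambda>(s, t). t \<otimes> s) ` (S \<times> T)"] conjI ballI)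
    fix x assume x: "x \<in> A"
    then obtain s where s: "s \<in> S" "f x = \<phi> s x"
      using S by blast
    then obtain t where t: "t \<in> T" "h (f x) = \<phi> t (f x)"
      using T x \<open>f ` A \<subseteq> B\<close> by blast
    have "(h \<circ> f) x = \<phi> (t \<otimes> s) x"
      using s t S(2) T(2) x \<open>A \<subseteq> E\<close> composition_rule[of x t s] by (simp add: subset_iff)
    then show "\<exists>g\<in>(\<lambda>(s, t). t \<otimes> s) ` (S \<times> T). (h \<circ> f) x = \<phi> g x"
      using s t by force
  qed (use S T in auto)
qed

lemma equidecomposable_image:
  assumes "piecewise G \<phi> X f" "inj_on f X" "f ` X \<subseteq> X" "X \<noteq> {}"
  shows "equidecomposable G X \<phi> (f ` X) X"
proof -
  obtain S where S: "finite S" "S \<subseteq> carrier G" "\<forall>x\<in>X. \<exists>g\<in>S. f x = \<phi> g x"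
    using assms(1) unfolding piecewise_def by blast
  obtain g and m :: nat where g: "S = g ` {i. i < m}"
    using S(1) by (auto simp: finite_conv_nat_seg_image)
  \<comment> \<open>Several group elements may agree with \<open>f\<close> at a point; the least
    index assigns each point to exactly one piece.\<close>
  define k where "k x = (LEAST i. i < m \<and> f x = \<phi> (g i) x)" for x
  have k: "k x < m \<and> f x = \<phi> (g (k x)) x" if "x \<in> X" for x
    unfolding k_def by (rule LeastI_ex) (use S(3) g that in auto)
  define Q where "Q i = {x\<in>X. k x = i}" for i
  have "f ` Q i = \<phi> (g i) ` Q i" for i
    using k unfolding Q_def by (intro image_cong) auto
  moreover have "disjoint_family_on (\<lambda>i. f ` Q i) {..<m}" "disjoint_family_on Q {..<m}"
    using assms(2) by (auto simp: disjoint_family_on_def Q_def inj_on_def)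
  moreover have "(\<Union>i<m. Q i) = X"
    using k by (auto simp: Q_def)
  moreover from this have "(\<Union>i<m. f ` Q i) = f ` X"
    by blast
  moreover have "\<forall>i<m. g i \<in> carrier G"
    using S(2) g by blast
  ultimately have "(\<forall>i<m. g i \<in> carrier G) \<and>
      disjoint_family_on (\<lambda>i. f ` Q i) {..<m} \<and> (\<Union>i<m. f ` Q i) = f ` X \<and>
      disjoint_family_on Q {..<m} \<and> (\<Union>i<m. Q i) = X \<and>
      (\<forall>i<m. f ` Q i = \<phi> (g i) ` Q i)"
    by blast
  moreover have "f ` X \<noteq> {}"
    using assms(4) by blast
  ultimately show ?thesis
    unfolding equidecomposable_def using assms(3,4) by blast
qed

lemma paradoxical_if_disjoint_self_maps:
  assumes "X \<noteq> {}"
    and "piecewise G \<phi> X p" "inj_on p X" "p ` X \<subseteq> X"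
    and "piecewise G \<phi> X q" "inj_on q X" "q ` X \<subseteq> X"
    and "p ` X \<inter> q ` X = {}"
  shows "paradoxical G X \<phi> X"
  unfolding paradoxical_def
  using assms equidecomposable_image[OF assms(2,3,4,1)] equidecomposable_image[OF assms(5,6,7,1)]
  by (intro conjI exI[of _ "p ` X"] exI[of _ "q ` X"]) auto

text \<open>Induction on \<open>C\<close>: points that \<open>g\<close> carries into
  \<open>A\<close> continue through \<open>p\<close>; the others, embedded in \<open>A\<close> by
  the induction hypothesis, continue through \<open>q\<close>. As \<open>p\<close> and
  \<open>q\<close> have disjoint images, the combined map is injective.\<close>

lemma (in group_action) piecewise_injection_into:
  assumes p: "piecewise G \<phi> A p" "inj_on p A" "p ` A \<subseteq> A"
    and q: "piecewise G \<phi> A q" "inj_on q A" "q ` A \<subseteq> A"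
    and disj: "p ` A \<inter> q ` A = {}" and "A \<subseteq> E"
    and "finite C" "C \<subseteq> carrier G" "Y \<subseteq> E" "\<forall>x\<in>Y. \<exists>g\<in>C. \<phi> g x \<in> A"
  shows "\<exists>F. piecewise G \<phi> Y F \<and> inj_on F Y \<and> F ` Y \<subseteq> A"
  using assms(9-)
proof (induction C arbitrary: Y rule: finite_induct)
  case empty
  then show ?case
    by (auto simp: piecewise_def)
next
  case (insert g C)
  define Z where "Z = {x\<in>Y. \<not> \<phi> g x \<in> A}"
  have "\<exists>F. piecewise G \<phi> Z F \<and> inj_on F Z \<and> F ` Z \<subseteq> A"
    by (rule insert.IH) (use insert.prems in \<open>auto simp: Z_def\<close>)
  then obtain F where F: "piecewise G \<phi> Z F" "inj_on F Z" "F ` Z \<subseteq> A"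
    by blast
  define H where "H = (\<lambda>x. if \<phi> g x \<in> A then (p \<circ> \<phi> g) x else (q \<circ> F) x)"
  have gY: "inj_on (\<phi> g) Y"
    using inj_prop[of g] insert.prems by (auto intro: inj_on_subset)
  have "piecewise G \<phi> Y H"
    unfolding H_def
  proof (rule piecewise_If)
    show "piecewise G \<phi> {x\<in>Y. \<phi> g x \<in> A} (p \<circ> \<phi> g)"
      by (rule piecewise_comp[OF piecewise_translation p(1)]) (use insert.prems in auto)
    show "piecewise G \<phi> {x\<in>Y. \<phi> g x \<notin> A} (q \<circ> F)"
      by (rule piecewise_comp[OF _ q(1)]) (use F insert.prems in \<open>auto simp: Z_def\<close>)
  qed
  moreover have "inj_on H Y"
  proof (rule inj_onI)
    fix x y assume xy: "x \<in> Y" "y \<in> Y" "H x = H y"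
    have Fz: "F z \<in> A" if "z \<in> Y" "\<phi> g z \<notin> A" for z
      using that F by (auto simp: Z_def)
    consider "\<phi> g x \<in> A" "\<phi> g y \<in> A" | "\<phi> g x \<notin> A" "\<phi> g y \<notin> A"
      using xy disj Fz by (force simp: H_def split: if_splits)
    then show "x = y"
    proof cases
      case 1
      then show ?thesis
        using xy p(2) gY by (auto simp: H_def inj_on_def)
    next
      case 2
      then have "F x = F y"
        using xy q(2) Fz by (auto simp: H_def inj_on_def)
      then show ?thesis
        using 2 xy F(2) by (auto simp: Z_def inj_on_def)
    qed
  qed
  moreover have "H ` Y \<subseteq> A"
    using p(3) q(3) F(3) by (auto simp: H_def Z_def image_subset_iff)
  ultimately show ?case
    by blast
qed

theorem (in group_action) paradoxical_if_covered:
  assumes p: "piecewise G \<phi> A p" "inj_on p A" "p ` A \<subseteq> A"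
    and q: "piecewise G \<phi> A q" "inj_on q A" "q ` A \<subseteq> A"
    and disj: "p ` A \<inter> q ` A = {}" and "A \<subseteq> E" "E \<noteq> {}"
    and "finite C" "C \<subseteq> carrier G" "\<forall>x\<in>E. \<exists>g\<in>C. \<phi> g x \<in> A"
  shows "paradoxical G E \<phi> E"
proof -
  obtain F where F: "piecewise G \<phi> E F" "inj_on F E" "F ` E \<subseteq> A"
    using piecewise_injection_into[OF p q disj assms(8,10,11) subset_refl assms(12)] by blast
  show ?thesis
  proof (rule paradoxical_if_disjoint_self_maps)
    show "piecewise G \<phi> E (p \<circ> F)" "piecewise G \<phi> E (q \<circ> F)"
      using piecewise_comp[OF F(1) p(1)] piecewise_comp[OF F(1) q(1)] F by auto
    show "inj_on (p \<circ> F) E" "inj_on (q \<circ> F) E"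
      using F p q by (auto intro: comp_inj_on inj_on_subset)
    show "(p \<circ> F) ` E \<subseteq> E" "(q \<circ> F) ` E \<subseteq> E" "(p \<circ> F) ` E \<inter> (q \<circ> F) ` E = {}"
      using F p q disj \<open>A \<subseteq> E\<close> by (auto simp: image_subset_iff) blast
  qed fact
qed

section \<open>Free actions of a free group of rank two\<close>

text \<open>The first component names the generator, the second distinguishes it from its
  inverse.\<close>

type_synonym letter = "bool \<times> bool"

definition linv :: "letter \<Rightarrow> letter"
  where "linv l = (fst l, \<not> snd l)"

lemma linv_linv [simp]: "linv (linv l) = l"
  by (simp add: linv_def)

lemma linv_neq [simp]: "linv l \<noteq> l"
  by (cases l) (simp add: linv_def)

abbreviation reduced :: "letter list \<Rightarrow> bool"
  where "reduced \<equiv> successively (\<lambda>l m. m \<noteq> linv l)"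

lemma reduced_inverse: "reduced w \<Longrightarrow> reduced (rev (map linv w))"
  by (simp add: successively_map, erule successively_mono) (metis linv_linv)

locale free_letter_action =
  fixes A :: "'x set" and act :: "letter \<Rightarrow> 'x \<Rightarrow> 'x"
  assumes act_in: "x \<in> A \<Longrightarrow> act l x \<in> A"
    and act_linv: "x \<in> A \<Longrightarrow> act (linv l) (act l x) = x"
    and free: "reduced w \<Longrightarrow> w \<noteq> [] \<Longrightarrow> x \<in> A \<Longrightarrow> foldr act w x \<noteq> x"
begin

lemma word_in: "x \<in> A \<Longrightarrow> foldr act w x \<in> A"
  by (induction w) (auto simp: act_in)

lemma act_linv': "x \<in> A \<Longrightarrow> act l (act (linv l) x) = x"
  using act_linv[of x "linv l"] by simp

lemma act_inj: "x \<in> A \<Longrightarrow> y \<in> A \<Longrightarrow> act l x = act l y \<Longrightarrow> x = y"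
  by (metis act_linv)

lemma word_inverse: "x \<in> A \<Longrightarrow> foldr act (rev (map linv w)) (foldr act w x) = x"
  by (induction w) (auto simp: act_linv word_in)

lemma word_reduce:
  assumes "x \<in> A"
  shows "\<exists>v. reduced v \<and> foldr act v x = foldr act w x"
proof (induction w)
  case Nil
  show ?case
    by (rule exI[of _ "[]"]) simp
next
  case (Cons l w)
  then obtain v where v: "reduced v" "foldr act v x = foldr act w x"
    by blast
  show ?case
  proof (cases "\<exists>u. v = linv l # u")
    case True
    then obtain u where u: "v = linv l # u" ..
    then have "foldr act u x = foldr act (l # w) x"
      using v(2) assms by (simp flip: v(2) add: act_linv' word_in)
    moreover have "reduced u"
      using v(1) u by (cases u) auto
    ultimately show ?thesis
      by blast
  next
    case False
    then have "reduced (l # v)"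
      using v(1) by (cases v) auto
    then show ?thesis
      using v(2) by (intro exI[of _ "l # v"]) simp
  qed
qed

text \<open>Injectivity strips equal first letters. At the first difference, the inverse of one word
  followed by the other is again reduced and fixes \<open>x\<close>, against freeness.\<close>

lemma word_unique:
  assumes "reduced v" "reduced w" "x \<in> A" "foldr act v x = foldr act w x"
  shows "v = w"
  using assms
proof (induction v arbitrary: w)
  case Nil
  then show ?case
    using free[of w x] by auto
next
  case (Cons l v)
  show ?case
  proof (cases w)
    case Nil
    then show ?thesis
      using free[of "l # v" x] Cons.prems by auto
  next
    case (Cons m u)
    show ?thesis
    proof (cases "l = m")
      case True
      then have "foldr act v x = foldr act u x"
        using Cons Cons.prems act_inj word_in by simp
      then show ?thesis
        using Cons.IH[of u] Cons.prems Cons True by (auto simp: successively_Cons)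
    next
      case False
      have "reduced (rev (map linv (l # v)) @ w)"
        using Cons.prems reduced_inverse[of "l # v"] False Cons
        by (auto simp: successively_append_iff)
      moreover have "foldr act (rev (map linv (l # v)) @ w) x = x"
        using word_inverse[OF Cons.prems(3), of "l # v"] Cons.prems(4) by simp
      ultimately show ?thesis
        using free[of "rev (map linv (l # v)) @ w" x] Cons.prems by simp
    qed
  qed
qed

text \<open>The choice looks only at the orbit as a set, so all points of an orbit share one
  representative.\<close>

definition rep :: "'x \<Rightarrow> 'x"
  where "rep x = (SOME r. r \<in> range (\<lambda>w. foldr act w x))"

lemma orbit_act: "x \<in> A \<Longrightarrow> range (\<lambda>w. foldr act w (act l x)) = range (\<lambda>w. foldr act w x)"
proof (intro equalityI subsetI)
  fix y assume x: "x \<in> A" and "y \<in> range (\<lambda>w. foldr act w (act l x))"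
  then obtain w where "y = foldr act w (act l x)"
    by blast
  then have "y = foldr act (w @ [l]) x"
    by simp
  then show "y \<in> range (\<lambda>w. foldr act w x)"
    by blast
next
  fix y assume x: "x \<in> A" and "y \<in> range (\<lambda>w. foldr act w x)"
  then obtain w where "y = foldr act w x"
    by blast
  then have "y = foldr act (w @ [linv l]) (act l x)"
    using x by (simp add: act_linv)
  then show "y \<in> range (\<lambda>w. foldr act w (act l x))"
    by blast
qed

lemma rep_act: "x \<in> A \<Longrightarrow> rep (act l x) = rep x"
  by (simp add: rep_def orbit_act)

lemma rep_word:
  assumes "x \<in> A"
  shows "rep x \<in> A" "\<exists>w. reduced w \<and> foldr act w (rep x) = x"
proof -
  have "rep x \<in> range (\<lambda>w. foldr act w x)"
    unfolding rep_def by (rule someI_ex) blast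
  then obtain w where w: "rep x = foldr act w x"
    by blast
  then show r: "rep x \<in> A"
    using assms word_in by simp
  have "foldr act (rev (map linv w)) (rep x) = x"
    using word_inverse[OF assms] w by simp
  then show "\<exists>w. reduced w \<and> foldr act w (rep x) = x"
    using word_reduce[OF r, of "rev (map linv w)"] by auto
qed

text \<open>In each orbit this is a copy of the reduced words with first letter \<open>l\<close>;
  the representative stands for the empty word.\<close>

definition starts :: "letter \<Rightarrow> 'x set"
  where "starts l = {x\<in>A. \<exists>w. reduced (l # w) \<and> foldr act (l # w) (rep x) = x}"

lemma starts_disjoint: "l \<noteq> m \<Longrightarrow> starts l \<inter> starts m = {}"
  using word_unique[of "l # _" "m # _"] rep_word(1) by (fastforce simp: starts_def)

lemma act_starts:
  assumes "x \<in> A" "x \<notin> starts (linv l)"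
  shows "act l x \<in> starts l"
proof -
  obtain w where w: "reduced w" "foldr act w (rep x) = x"
    using rep_word assms by blast
  \<comment> \<open>A first letter \<open>linv l\<close> would put \<open>x\<close> in
    \<open>starts (linv l)\<close>, so prefixing \<open>l\<close> cancels nothing.\<close>
  have "reduced (l # w)"
    using w assms by (cases w) (auto simp: starts_def)
  then show ?thesis
    using w assms by (auto simp: starts_def act_in rep_act intro!: exI[of _ w])
qed

lemma starts_subset: "starts l \<subseteq> A"
  by (auto simp: starts_def)

text \<open>
  If \<open>F\<close> is free and \<open>W l\<close> consists of the reduced words starting with \<open>l\<close>, then
  \<open>F = W (l\<inverse>) \<union> l\<inverse> (W l)\<close>; so moving the complement of \<open>W (l\<inverse>)\<close> by \<open>l\<close> embeds \<open>F\<close>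
  into \<open>W l \<union> W (l\<inverse>)\<close>, and the two generators give embeddings with disjoint images.
\<close>

definition squeeze :: "letter \<Rightarrow> 'x \<Rightarrow> 'x"
  where "squeeze l x = (if x \<in> starts (linv l) then x else act l x)"

lemma squeeze_image: "squeeze l ` A \<subseteq> starts l \<union> starts (linv l)"
  using act_starts[of _ l] by (auto simp: squeeze_def)

lemma squeeze_inj: "inj_on (squeeze l) A"
proof (rule inj_onI)
  fix x y assume "x \<in> A" "y \<in> A" "squeeze l x = squeeze l y"
  then show "x = y"
    using act_starts[of x l] act_starts[of y l] starts_disjoint[of l "linv l"] act_inj[of x y l]
    by (auto simp: squeeze_def split: if_splits dest: linv_neq[THEN not_sym, THEN notE])
qed

lemma squeeze_disjoint: "squeeze (False, s) ` A \<inter> squeeze (True, t) ` A = {}"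
proof -
  have "(starts (False, s) \<union> starts (linv (False, s))) \<inter>
      (starts (True, t) \<union> starts (linv (True, t))) = {}"
    by (simp add: Int_Un_distrib Int_Un_distrib2 starts_disjoint linv_def)
  then show ?thesis
    using squeeze_image[of "(False, s)"] squeeze_image[of "(True, t)"] by blast
qed

end

theorem (in group_action) paradoxical_if_free_letter_action:
  assumes "free_letter_action A (\<phi> \<circ> \<gamma>)" "A \<subseteq> E" "E \<noteq> {}" "range \<gamma> \<subseteq> carrier G"
    and "finite C" "C \<subseteq> carrier G" "\<forall>x\<in>E. \<exists>g\<in>C. \<phi> g x \<in> A"
  shows "paradoxical G E \<phi> E"
proof -
  interpret free_letter_action A "\<phi> \<circ> \<gamma>"
    by fact
  interpret group G
    using group_hom by (simp add: group_hom_def)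
  have "piecewise G \<phi> A (squeeze l)" for l
    unfolding squeeze_def
  proof (rule piecewise_If)
    have "\<forall>x\<in>A. x = \<phi> \<one> x"
      using \<open>A \<subseteq> E\<close> by (auto simp flip: id_eq_one)
    then show "piecewise G \<phi> {x\<in>A. x \<in> starts (linv l)} (\<lambda>x. x)"
      unfolding piecewise_def by (intro exI[of _ "{\<one>}"]) auto
    show "piecewise G \<phi> {x\<in>A. x \<notin> starts (linv l)} ((\<phi> \<circ> \<gamma>) l)"
      using assms(4) by (auto intro: piecewise_translation)
  qed
  moreover have "squeeze l ` A \<subseteq> A" for l
    using squeeze_image starts_subset by blast
  ultimately show ?thesis
    using squeeze_inj squeeze_disjoint[of False False] assms
    by (intro paradoxical_if_covered[of A "squeeze (False, False)" "squeeze (True, False)" C])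
qed

section \<open>Integer quaternions\<close>

lemma quat_sel_simps [simp]:
  "qre (x + y) = qre x + qre y" "qi (x + y) = qi x + qi y"
  "qj (x + y) = qj x + qj y" "qk (x + y) = qk x + qk y"
  "qre (x - y) = qre x - qre y" "qi (x - y) = qi x - qi y"
  "qj (x - y) = qj x - qj y" "qk (x - y) = qk x - qk y"
  "qre (r *\<^sub>R x) = r * qre x" "qi (r *\<^sub>R x) = r * qi x"
  "qj (r *\<^sub>R x) = r * qj x" "qk (r *\<^sub>R x) = r * qk x"
  "qre (kconj x) = qre x" "qi (kconj x) = - qi x" "qj (kconj x) = - qj x" "qk (kconj x) = - qk x"
  "qre 0 = 0" "qi 0 = 0" "qj 0 = 0" "qk 0 = 0"
  "qre 1 = 1" "qi 1 = 0" "qj 1 = 0" "qk 1 = 0"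
  by (simp_all add: quat_defs)

lemma quat_sel_times:
  "qre (x * y) = qre x * qre y - qi x * qi y - qj x * qj y - qk x * qk y"
  "qi (x * y) = qre x * qi y + qi x * qre y + qj x * qk y - qk x * qj y"
  "qj (x * y) = qre x * qj y - qi x * qk y + qj x * qre y + qk x * qi y"
  "qk (x * y) = qre x * qk y + qi x * qj y - qj x * qi y + qk x * qre y"
  by (simp_all add: times_quat_def)

lemma kconj_mult_quat: "kconj x * x = qnorm2 x *\<^sub>R (1::quat)"
  and mult_kconj_quat: "x * kconj x = qnorm2 x *\<^sub>R (1::quat)"
  by (simp_all add: quat_eq_iff quat_sel_times qnorm2_def power2_eq_square)

lemma kconj_scaleR_quat [simp]: "kconj (r *\<^sub>R x) = r *\<^sub>R kconj (x::quat)"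
  by (simp add: quat_eq_iff)

lemma qnorm2_mult: "qnorm2 (x * y) = qnorm2 x * qnorm2 y"
  by (simp add: quat_sel_times qnorm2_def power2_eq_square algebra_simps)

lemma qnorm2_one [simp]: "qnorm2 1 = 1"
  by (simp add: qnorm2_def)

lemma qnorm2_scaleR: "qnorm2 (r *\<^sub>R x) = r\<^sup>2 * qnorm2 x"
  by (simp add: qnorm2_def power2_eq_square algebra_simps)

lemma qnorm2_kconj [simp]: "qnorm2 (kconj x) = qnorm2 x"
  by (simp add: qnorm2_def)

text \<open>These are the Lipschitz quaternions.\<close>

definition qint :: "quat \<Rightarrow> bool"
  where "qint x \<longleftrightarrow> qre x \<in> \<int> \<and> qi x \<in> \<int> \<and> qj x \<in> \<int> \<and> qk x \<in> \<int>"

lemma qint_add: "qint x \<Longrightarrow> qint y \<Longrightarrow> qint (x + y)"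
  and qint_diff: "qint x \<Longrightarrow> qint y \<Longrightarrow> qint (x - y)"
  and qint_mult: "qint x \<Longrightarrow> qint y \<Longrightarrow> qint (x * y)"
  and qint_kconj: "qint x \<Longrightarrow> qint (kconj x)"
  and qint_scaleR: "qint x \<Longrightarrow> r \<in> \<int> \<Longrightarrow> qint (r *\<^sub>R x)"
  by (auto simp: qint_def quat_sel_times)

section \<open>Words of integer quaternions modulo 2 and modulo 5\<close>

definition qdvd5 :: "quat \<Rightarrow> bool"
  where "qdvd5 x \<longleftrightarrow> (\<exists>y. qint y \<and> x = 5 *\<^sub>R y)"

lemma qdvd5_diff:
  assumes "qdvd5 x" "qdvd5 y"
  shows "qdvd5 (x - y)"
proof -
  obtain x' y' where "qint x'" "x = 5 *\<^sub>R x'" "qint y'" "y = 5 *\<^sub>R y'"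
    using assms unfolding qdvd5_def by blast
  then show ?thesis
    unfolding qdvd5_def
    by (intro exI[of _ "x' - y'"]) (simp add: qint_diff scaleR_diff_right)
qed

lemma qdvd5_mult:
  assumes "qint x" "qdvd5 y"
  shows "qdvd5 (x * y)"
proof -
  obtain y' where "qint y'" "y = 5 *\<^sub>R y'"
    using assms unfolding qdvd5_def by blast
  then show ?thesis
    unfolding qdvd5_def using assms by (intro exI[of _ "x * y'"]) (simp add: qint_mult)
qed

definition letter_quat :: "letter \<Rightarrow> quat"
  where "letter_quat l = (let e = (if snd l then 2 else -2)
    in if fst l then Quat 1 0 e 0 else Quat 1 e 0 0)"

lemma qint_letter_quat: "qint (letter_quat l)"
  by (simp add: letter_quat_def qint_def Let_def)

lemma letter_quat_linv: "letter_quat (linv l) = kconj (letter_quat l)"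
  by (simp add: letter_quat_def linv_def kconj_quat_def Let_def)

lemma qnorm2_letter_quat: "qnorm2 (letter_quat l) = 5"
  by (simp add: letter_quat_def qnorm2_def Let_def)

abbreviation word_quat :: "letter list \<Rightarrow> quat"
  where "word_quat w \<equiv> prod_list (map letter_quat w)"

text \<open>Every letter is \<open>1\<close> modulo 2, and products preserve this. The real part of
  a word is therefore odd, which excludes half-turns.\<close>

lemma word_quat_odd: "\<exists>y. qint y \<and> word_quat w = 1 + 2 *\<^sub>R y"
proof (induction w)
  case Nil
  show ?case
    by (rule exI[of _ 0]) (simp add: qint_def)
next
  case (Cons l w)
  then obtain y where y: "qint y" "word_quat w = 1 + 2 *\<^sub>R y"
    by blast
  define e where "e = (if snd l then 1 else -1 :: real)"
  define x where "x = (if fst l then Quat 0 0 e 0 else Quat 0 e 0 0)"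
  have "letter_quat l = 1 + 2 *\<^sub>R x"
    by (simp add: letter_quat_def x_def e_def Let_def quat_eq_iff)
  then have "word_quat (l # w) = 1 + 2 *\<^sub>R (x + y + 2 *\<^sub>R (x * y))"
    using y(2) by (simp add: quat_eq_iff quat_sel_times algebra_simps)
  moreover have "qint x"
    by (simp add: qint_def x_def e_def)
  ultimately show ?case
    using y(1) by (metis Ints_numeral qint_add qint_mult qint_scaleR)
qed

lemma qint_word_quat: "qint (word_quat w)"
  by (induction w) (simp_all add: qint_mult qint_letter_quat qint_def[of 1])

lemma qre_word_quat: "qre (word_quat w) \<noteq> 0"
proof -
  obtain y where y: "qint y" "word_quat w = 1 + 2 *\<^sub>R y"
    using word_quat_odd by blast
  then obtain n where "qre y = of_int n"
    by (auto simp: qint_def elim: Ints_cases)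
  then have "qre (word_quat w) = of_int (1 + 2 * n)"
    using y by simp
  moreover have "1 + 2 * n \<noteq> 0"
    by presburger
  ultimately show ?thesis
    by (simp only: of_int_eq_0_iff not_False_eq_True)
qed

lemma qnorm2_word_quat: "qnorm2 (word_quat w) = 5 ^ length w"
  by (induction w) (simp_all add: qnorm2_mult qnorm2_letter_quat)

text \<open>Let \<open>m\<close> be the second letter and \<open>u\<close> the product without the
  first letter \<open>l\<close>. Multiplying \<open>u\<close> by the letter inverse to
  \<open>m\<close> gives a multiple of 5. If \<open>l\<close> did so too, the difference of these
  two letters would as well, and its conjugate turns this into divisibility of \<open>u\<close> up
  to a factor prime to 5.\<close>

lemma word_quat_not_dvd5:
  assumes "reduced w" "w \<noteq> []"
  shows "\<not> qdvd5 (word_quat w)"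
  using assms
proof (induction w)
  case (Cons l w)
  show ?case
  proof (cases w)
    case Nil
    have "(1::real) \<noteq> 5 * y" if "y \<in> \<int>" for y
    proof -
      obtain n where "y = of_int n"
        using \<open>y \<in> \<int>\<close> by (elim Ints_cases)
      moreover have "1 \<noteq> 5 * n"
        by presburger
      ultimately show ?thesis
        by (metis of_int_1 of_int_eq_iff of_int_mult of_int_numeral)
    qed
    moreover have "qre (letter_quat l) = 1"
      by (simp add: letter_quat_def Let_def)
    ultimately show ?thesis
      using Nil by (auto simp: qdvd5_def qint_def)
  next
    case (Cons m v)
    define u where "u = word_quat w"
    have "reduced w" "m \<noteq> linv l"
      using Cons.prems Cons by auto
    then have u: "\<not> qdvd5 u"
      using Cons.IH Cons by (simp add: u_def)
    show ?thesis
    proof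
      assume "qdvd5 (word_quat (l # w))"
      then have 1: "qdvd5 (letter_quat l * u)"
        by (simp add: u_def)
      have "letter_quat (linv m) * u = 5 *\<^sub>R word_quat v"
        by (simp add: u_def Cons letter_quat_linv kconj_mult_quat qnorm2_letter_quat
            flip: mult.assoc)
      then have 2: "qdvd5 (letter_quat (linv m) * u)"
        using qint_word_quat unfolding qdvd5_def by blast
      text \<open>Two distinct letters differ by a quaternion whose norm is prime to \<open>5\<close>.\<close>
      define d where "d = letter_quat l - letter_quat (linv m)"
      have "qdvd5 (d * u)"
        using qdvd5_diff[OF 1 2] by (simp add: d_def left_diff_distrib)
      moreover have "qint (kconj d)"
        by (simp add: d_def qint_diff qint_kconj qint_letter_quat)
      ultimately have "qdvd5 (kconj d * (d * u))"
        by (rule qdvd5_mult[rotated])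
      then have 3: "qdvd5 (qnorm2 d *\<^sub>R u)"
        by (simp add: kconj_mult_quat flip: mult.assoc)
      have "qnorm2 d = 8 \<or> qnorm2 d = 16"
        using \<open>m \<noteq> linv l\<close>
        by (cases l; cases m) (auto simp: d_def letter_quat_def linv_def qnorm2_def Let_def)
      \<comment> \<open>Scaling to 16 treats both norms at once; subtracting \<open>15\<close> times
        \<open>u\<close> then leaves \<open>u\<close> itself.\<close>
      then have "\<exists>a\<in>\<int>. a * qnorm2 d = 16"
        by (metis Ints_1 Ints_numeral mult_1 mult_2 numeral_Bit0)
      then obtain a where a: "a \<in> \<int>" "a * qnorm2 d = 16"
        by blast
      have "qint (a *\<^sub>R 1)"
        using a by (simp add: qint_def)
      from qdvd5_mult[OF this 3] have "qdvd5 (16 *\<^sub>R u)"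
        using a by (simp add: mult.commute)
      moreover have "qdvd5 (15 *\<^sub>R u)"
        unfolding qdvd5_def using qint_word_quat[of w]
        by (intro exI[of _ "3 *\<^sub>R u"]) (simp add: qint_scaleR u_def)
      ultimately have "qdvd5 (16 *\<^sub>R u - 15 *\<^sub>R u)"
        by (rule qdvd5_diff)
      then show False
        using u by (simp flip: scaleR_diff_left)
    qed
  qed
qed simp

text \<open>A real value would be an integer whose square is a positive power of 5, hence divisible
  by 5.\<close>

lemma word_quat_not_real:
  assumes "reduced w" "w \<noteq> []"
  shows "word_quat w \<noteq> r *\<^sub>R 1"
proof
  assume r: "word_quat w = r *\<^sub>R 1"
  then have "r \<in> \<int>"
    using qint_word_quat[of w] by (simp add: qint_def)
  then obtain n where n: "r = of_int n"
    by (elim Ints_cases)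
  have "of_int (n ^ 2) = (of_int (5 ^ length w) :: real)"
    using qnorm2_word_quat[of w] r n by (simp add: qnorm2_scaleR)
  then have "n ^ 2 = 5 ^ length w"
    by (simp only: of_int_eq_iff)
  moreover have "(5::int) dvd 5 ^ length w"
    using assms by (simp add: dvd_power)
  moreover have "prime (5::int)"
    by simp
  ultimately have "5 dvd n"
    by (metis prime_dvd_power)
  then obtain k where "n = 5 * k" ..
  then have "word_quat w = 5 *\<^sub>R (of_int k *\<^sub>R 1)"
    using r n by simp
  then have "qdvd5 (word_quat w)"
    unfolding qdvd5_def by (intro exI[of _ "of_int k *\<^sub>R 1"]) (simp add: qint_def)
  then show False
    using word_quat_not_dvd5[OF assms] by simp
qed

section \<open>Rational directions\<close>

text \<open>Zero counts as rational, so a direction that is not rational is nonzero.\<close>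

definition rational_direction :: "quat \<Rightarrow> bool"
  where "rational_direction x \<longleftrightarrow> (\<exists>t y. qint y \<and> x = t *\<^sub>R y)"

lemma rational_direction_scaleR: "rational_direction x \<Longrightarrow> rational_direction (r *\<^sub>R x)"
  unfolding rational_direction_def by (metis scaleR_scaleR)

lemma rational_direction_conjugate:
  assumes "qint u" "rational_direction x"
  shows "rational_direction (u * x * kconj u)"
proof -
  obtain t y where "qint y" "x = t *\<^sub>R y"
    using assms unfolding rational_direction_def by blast
  then show ?thesis
    unfolding rational_direction_def using assms
    by (intro exI[of _ t] exI[of _ "u * y * kconj u"]) (simp add: qint_mult qint_kconj)
qed

text \<open>
  Conjugation by \<open>u\<close> rotates the pure quaternions about the axis \<open>Im u\<close>. As \<open>Re u \<noteq> 0\<close>, it is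
  not a half-turn, so the axis is the only line that it maps to itself.
\<close>

lemma conjugation_fixed_line:
  assumes T: "qre T = 0" "T \<noteq> 0" and eq: "u * T * kconj u = r *\<^sub>R T"
    and u: "qre u \<noteq> 0" "u \<noteq> qre u *\<^sub>R 1"
  shows "\<exists>t. T = t *\<^sub>R (u - qre u *\<^sub>R 1)"
proof -
  define s p q m where "s = qre u" "p = qi u" "q = qj u" "m = qk u"
  define x y z where "x = qi T" "y = qj T" "z = qk T"
  define N where "N = qnorm2 u"
  note defs = s_p_q_m_def x_y_z_def
  define X Y Z where "X = q * z - m * y" "Y = m * x - p * z" "Z = p * y - q * x"
  have "(u * T * kconj u) * u = (r *\<^sub>R T) * u"
    by (simp only: eq)
  then have E: "N *\<^sub>R (u * T) = r *\<^sub>R (T * u)"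
    by (simp add: mult.assoc kconj_mult_quat N_def)
  have c: "N * (s * x + X) = r * (s * x - X)" "N * (s * y + Y) = r * (s * y - Y)"
    "N * (s * z + Z) = r * (s * z - Z)"
    using arg_cong[OF E, of qi] arg_cong[OF E, of qj] arg_cong[OF E, of qk] T(1)
    by (simp_all add: quat_sel_times X_Y_Z_def algebra_simps flip: defs)
  have orth: "x * X + y * Y + z * Z = 0"
    by (simp add: X_Y_Z_def algebra_simps)
  have pos: "x * x + y * y + z * z > 0"
    using qnorm2_pos[of T] T by (simp add: qnorm2_def zero_quat_def power2_eq_square defs)
  \<comment> \<open>The inner product with \<open>T\<close> removes the cross product and, as
    \<open>s\<close> is nonzero, forces \<open>N = r\<close>.\<close>
  have "x * (N * (s * x + X)) + y * (N * (s * y + Y)) + z * (N * (s * z + Z)) =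
      x * (r * (s * x - X)) + y * (r * (s * y - Y)) + z * (r * (s * z - Z))"
    by (simp only: c)
  then have "(N - r) * s * (x * x + y * y + z * z) = - (N + r) * (x * X + y * Y + z * Z)"
    by (simp add: algebra_simps)
  then have "N = r"
    using orth pos u by (simp add: defs)
  moreover have "N > 0"
    using qnorm2_pos[of u] u(1) by (force simp: N_def)
  \<comment> \<open>With \<open>N = r\<close> the equations say that the cross product is zero, so
    \<open>T\<close> is parallel to the imaginary part of \<open>u\<close>.\<close>
  ultimately have zero: "X = 0" "Y = 0" "Z = 0"
    using c by (simp_all add: algebra_simps)
  have "T = t *\<^sub>R (u - qre u *\<^sub>R 1) \<longleftrightarrow> x = t * p \<and> y = t * q \<and> z = t * m" for t
    using T(1) by (simp add: quat_eq_iff defs)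
  moreover have "\<exists>t. x = t * p \<and> y = t * q \<and> z = t * m"
  proof -
    consider "p \<noteq> 0" | "q \<noteq> 0" | "m \<noteq> 0"
      using u(2) by (auto simp: quat_eq_iff defs)
    then show ?thesis
    proof cases
      case 1
      then show ?thesis
        using zero by (intro exI[of _ "x / p"]) (simp add: X_Y_Z_def field_simps)
    next
      case 2
      then show ?thesis
        using zero by (intro exI[of _ "y / q"]) (simp add: X_Y_Z_def field_simps)
    next
      case 3
      then show ?thesis
        using zero by (intro exI[of _ "z / m"]) (simp add: X_Y_Z_def field_simps)
    qed
  qed
  ultimately show ?thesis
    by blast
qed

lemma reduced_word_fixed_line:
  assumes "reduced w" "w \<noteq> []" "qre T = 0" "T \<noteq> 0"
    and "word_quat w * T * kconj (word_quat w) = r *\<^sub>R T"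
  shows "rational_direction T"
proof -
  obtain t where "T = t *\<^sub>R (word_quat w - qre (word_quat w) *\<^sub>R 1)"
    using conjugation_fixed_line[OF assms(3-5) qre_word_quat]
      word_quat_not_real[OF assms(1,2)] by blast
  moreover have "qint (word_quat w - qre (word_quat w) *\<^sub>R 1)"
    using qint_word_quat[of w] by (simp add: qint_def)
  ultimately show ?thesis
    unfolding rational_direction_def by blast
qed

section \<open>Rotations that destroy rationality\<close>

lemma sqrt_2_times_int:
  fixes a b :: int
  assumes "real_of_int a = sqrt 2 * real_of_int b"
  shows "a = 0 \<and> b = 0"
proof (cases "b = 0")
  case False
  have "(real_of_int a)\<^sup>2 = 2 * (real_of_int b)\<^sup>2"
    by (simp add: assms power_mult_distrib)
  then have "real_of_int (a\<^sup>2) = real_of_int (2 * b\<^sup>2)"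
    by simp
  then have eq: "a\<^sup>2 = 2 * b\<^sup>2"
    by (simp only: of_int_eq_iff)
  then have "a \<noteq> 0"
    using False by auto
  have "prime (2::int)"
    by simp
  \<comment> \<open>The exponent of 2 is even on the left of \<open>eq\<close> and odd on the
    right.\<close>
  then have "multiplicity 2 (a\<^sup>2) = 2 * multiplicity 2 a"
    "multiplicity 2 (2 * b\<^sup>2) = 1 + 2 * multiplicity 2 b"
    using False \<open>a \<noteq> 0\<close>
    by (auto simp: prime_elem_multiplicity_power_distrib prime_elem_multiplicity_mult_distrib)
  then show ?thesis
    using eq by (metis dvd_triv_left even_plus_one_iff add.commute)
qed (use assms in simp)

text \<open>
  Conjugation by \<open>1 + \<surd>2 k\<close> is a rotation of the first two coordinates by an angle whose tangent
  is a rational multiple of \<open>\<surd>2\<close>; it maps no rational slope to a rational slope.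
\<close>

definition irrational_turn :: quat
  where "irrational_turn = (1 / sqrt 3) *\<^sub>R Quat 1 0 0 (sqrt 2)"

lemma rational_direction_irrational_turn:
  assumes "rational_direction T" "qi T \<noteq> 0 \<or> qj T \<noteq> 0"
  shows "\<not> rational_direction (irrational_turn * T * kconj irrational_turn)"
proof
  define U where "U = Quat 1 0 0 (sqrt 2) * T * kconj (Quat 1 0 0 (sqrt 2))"
  assume "rational_direction (irrational_turn * T * kconj irrational_turn)"
  then have "rational_direction ((1/3) *\<^sub>R U)"
    by (simp add: irrational_turn_def U_def)
  then obtain s y where "qint y" "(1/3) *\<^sub>R U = s *\<^sub>R y"
    unfolding rational_direction_def by blast
  moreover obtain t x where "qint x" and T: "T = t *\<^sub>R x"
    using assms unfolding rational_direction_def by blast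
  ultimately obtain a b c d :: int
    where ab: "qi x = of_int a" "qj x = of_int b" and cd: "qi y = of_int c" "qj y = of_int d"
    by (auto simp: qint_def elim!: Ints_cases)
  have "t \<noteq> 0"
    using assms(2) T by auto
  have "U = (3 * s) *\<^sub>R y"
    using \<open>(1/3) *\<^sub>R U = s *\<^sub>R y\<close> by (metis scaleR_one scaleR_scaleR
        nonzero_mult_div_cancel_left times_divide_eq_right mult.right_neutral zero_neq_numeral)
  moreover have "qi U = t * (- a - 2 * sqrt 2 * b)" "qj U = t * (2 * sqrt 2 * a - b)"
    by (simp_all add: U_def T quat_sel_times ab algebra_simps)
  ultimately have 1: "t * (- a - 2 * sqrt 2 * b) = 3 * s * c"
    and 2: "t * (2 * sqrt 2 * a - b) = 3 * s * d"
    by (auto simp: cd)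
  have "t * ((- a - 2 * sqrt 2 * b) * d) = t * ((2 * sqrt 2 * a - b) * c)"
    using arg_cong[OF 1, of "\<lambda>v. v * d"] arg_cong[OF 2, of "\<lambda>v. v * c"]
    by (simp only: ac_simps)
  then have "(- a - 2 * sqrt 2 * b) * d = (2 * sqrt 2 * a - b) * c"
    using \<open>t \<noteq> 0\<close> by (simp only: mult_cancel_left) simp
  then have "real_of_int (b * c - a * d) = sqrt 2 * real_of_int (2 * (a * c + b * d))"
    by (simp add: algebra_simps)
  from sqrt_2_times_int[OF this] have "b * c - a * d = 0" "a * c + b * d = 0"
    by auto
  \<comment> \<open>The vector \<open>(c, d)\<close> is both parallel and orthogonal to
    \<open>(a, b)\<close>, hence zero.\<close>
  then have "(a * a + b * b) * c = 0" "(a * a + b * b) * d = 0"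
    by algebra+
  moreover have "a \<noteq> 0 \<or> b \<noteq> 0"
    using assms(2) T ab by auto
  then have "a * a + b * b \<noteq> 0"
    by (simp add: sum_squares_eq_zero_iff)
  ultimately have "c = 0" "d = 0"
    by auto
  then have "real_of_int b = sqrt 2 * real_of_int (2 * a)"
    using 2 \<open>t \<noteq> 0\<close> by auto
  from sqrt_2_times_int[OF this] show False
    using \<open>a \<noteq> 0 \<or> b \<noteq> 0\<close> by simp
qed

text \<open>Conjugation by \<open>(1 + i + j + k) / 2\<close> permutes \<open>i\<close>, \<open>j\<close>, \<open>k\<close> cyclically.\<close>

definition cyclic_turn :: quat
  where "cyclic_turn = Quat (1/2) (1/2) (1/2) (1/2)"

lemma qnorm2_turns [simp]: "qnorm2 irrational_turn = 1" "qnorm2 cyclic_turn = 1"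
  by (simp_all add: irrational_turn_def cyclic_turn_def qnorm2_scaleR)
    (simp_all add: qnorm2_def power2_eq_square)

text \<open>The irrational turn fixes the \<open>k\<close> axis, so a vector on that axis is first
  moved to the \<open>i\<close> axis by the cyclic turn.\<close>

lemma ex_turn_irrational:
  assumes "qre T = 0" "T \<noteq> 0"
  shows "\<exists>u\<in>{1, cyclic_turn, irrational_turn, irrational_turn * cyclic_turn}.
    \<not> rational_direction (u * T * kconj u)"
proof -
  have *: "\<exists>u\<in>{1, irrational_turn}. \<not> rational_direction (u * S * kconj u)"
    if "qi S \<noteq> 0 \<or> qj S \<noteq> 0" for S
    using rational_direction_irrational_turn[OF _ that] kconj_mult_quat[of 1]
    by (cases "rational_direction S") auto
  show ?thesis
  proof (cases "qi T \<noteq> 0 \<or> qj T \<noteq> 0")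
    case True
    then show ?thesis
      using * by blast
  next
    case False
    then have "qi (cyclic_turn * T * kconj cyclic_turn) \<noteq> 0"
      using assms by (simp add: quat_eq_iff cyclic_turn_def quat_sel_times)
    then obtain u where u: "u \<in> {1, irrational_turn}"
      "\<not> rational_direction (u * (cyclic_turn * T * kconj cyclic_turn) * kconj u)"
      using * by blast
    then have "\<not> rational_direction ((u * cyclic_turn) * T * kconj (u * cyclic_turn))"
      by (simp add: kconj_mult mult.assoc)
    then show ?thesis
      using u(1) by (intro bexI[of _ "u * cyclic_turn"]) auto
  qed
qed

section \<open>Unit quaternions acting on a projective space\<close>

lemma line_action_right_line:
  assumes "f \<in> carrier isometry_group" "v \<noteq> 0"
  shows "line_action f (right_line v) = right_line (f v)"
  using assms image_right_line[of f v]
  by (auto simp: line_action_def projective_space_def isometry_group_def)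

lemma right_line_self: "v \<in> right_line v"
  by (auto simp: right_line_def rscale_def vec_eq_iff intro!: image_eqI[of _ _ 1])

lemma isometry_nonzero:
  assumes "f \<in> carrier isometry_group" "v \<noteq> 0"
  shows "f v \<noteq> 0"
proof -
  have "f 0 + f 0 = f 0"
    using assms(1) by (metis (mono_tags, lifting) isometry_group_def mem_Collect_eq
        partial_object.select_convs(1) right_linear_def add_0)
  then have "f 0 = 0"
    by simp
  moreover have "inj f"
    using assms(1) by (simp add: isometry_group_def bij_def)
  ultimately show ?thesis
    using assms(2) by (metis injD)
qed

lemma isometry_comp:
  "f \<in> carrier isometry_group \<Longrightarrow> h \<in> carrier isometry_group \<Longrightarrow>
    f \<circ> h \<in> carrier isometry_group"
  by (auto simp: isometry_group_def right_linear_def intro: bij_comp)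

text \<open>The data that each of the three cases has to supply. \<open>scale\<close> lets
  \<open>\<tau>\<close> act on lines, and \<open>cover\<close> takes care of the vectors at which
  \<open>\<tau>\<close> vanishes.\<close>

locale quat_rotation_action =
  fixes \<rho> :: "quat \<Rightarrow> 'k::conj_div_algebra ^ 'n \<Rightarrow> 'k ^ 'n" and \<tau> :: "'k ^ 'n \<Rightarrow> quat"
  assumes isometry: "qnorm2 u = 1 \<Longrightarrow> \<rho> u \<in> carrier isometry_group"
    and mult: "\<rho> (u * w) v = \<rho> u (\<rho> w v)"
    and one: "\<rho> 1 v = v"
    and equivariant: "\<tau> (\<rho> u v) = u * \<tau> v * kconj u"
    and pure: "qre (\<tau> v) = 0"
    and scale: "c \<noteq> 0 \<Longrightarrow> \<exists>r. r \<noteq> 0 \<and> \<tau> (v \<cdot>\<^sub>r c) = r *\<^sub>R \<tau> v"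
    and cover: "\<exists>S. finite S \<and> S \<subseteq> carrier isometry_group \<and>
      (\<forall>v. v \<noteq> 0 \<longrightarrow> (\<exists>s\<in>S. \<tau> (s v) \<noteq> 0))"
begin

definition unit_letter :: "letter \<Rightarrow> quat"
  where "unit_letter l = (1 / sqrt 5) *\<^sub>R letter_quat l"

lemma qnorm2_unit_letter: "qnorm2 (unit_letter l) = 1"
  by (simp add: unit_letter_def qnorm2_scaleR qnorm2_letter_quat power_divide)

lemma unit_letter_linv: "unit_letter (linv l) * unit_letter l = 1"
  using qnorm2_unit_letter[of l] kconj_mult_quat[of "unit_letter l"]
  by (simp add: unit_letter_def letter_quat_linv)

lemma unit_word:
  "prod_list (map unit_letter w) = (1 / sqrt 5 ^ length w) *\<^sub>R word_quat w"
  by (induction w) (simp_all add: unit_letter_def)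

lemma qnorm2_unit_word: "qnorm2 (prod_list (map unit_letter w)) = 1"
  by (induction w) (simp_all add: qnorm2_mult qnorm2_unit_letter)

text \<open>By \<open>scale\<close>, the outcome is the same for every nonzero vector of a
  line.\<close>

definition irrational_lines :: "('k ^ 'n) set set"
  where "irrational_lines = right_line ` {v. v \<noteq> 0 \<and> \<not> rational_direction (\<tau> v)}"

lemma irrational_linesI:
  "v \<noteq> 0 \<Longrightarrow> \<not> rational_direction (\<tau> v) \<Longrightarrow> right_line v \<in> irrational_lines"
  by (auto simp: irrational_lines_def)

lemma rational_direction_unit_letter:
  assumes "rational_direction (\<tau> (\<rho> (unit_letter l) v))"
  shows "rational_direction (\<tau> v)"
proof -
  have "v = \<rho> (unit_letter (linv l)) (\<rho> (unit_letter l) v)"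
    by (simp add: one unit_letter_linv flip: mult)
  then have "\<tau> v = unit_letter (linv l) * \<tau> (\<rho> (unit_letter l) v) * kconj (unit_letter (linv l))"
    by (metis equivariant)
  also have "\<dots> = (1 / 5) *\<^sub>R (letter_quat (linv l) * \<tau> (\<rho> (unit_letter l) v) *
      kconj (letter_quat (linv l)))"
    by (simp add: unit_letter_def)
  finally show ?thesis
    using assms by (metis rational_direction_scaleR rational_direction_conjugate qint_letter_quat)
qed

lemma line_action_word:
  assumes "v \<noteq> 0"
  shows "foldr (line_action \<circ> (\<rho> \<circ> unit_letter)) w (right_line v) =
    right_line (\<rho> (prod_list (map unit_letter w)) v)"
proof (induction w)
  case Nil
  then show ?case
    by (simp add: one)
next
  case (Cons l w)
  have "\<rho> (prod_list (map unit_letter w)) v \<noteq> 0"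
    by (rule isometry_nonzero[OF isometry[OF qnorm2_unit_word] assms])
  then show ?case
    using Cons by (simp add: line_action_right_line isometry qnorm2_unit_letter mult)
qed

lemma free_letter_action_lines:
  "free_letter_action irrational_lines (line_action \<circ> (\<rho> \<circ> unit_letter))"
proof
  fix x l assume "x \<in> irrational_lines"
  then obtain v where v: "x = right_line v" "v \<noteq> 0" "\<not> rational_direction (\<tau> v)"
    by (auto simp: irrational_lines_def)
  have nz: "\<rho> (unit_letter l) v \<noteq> 0"
    by (rule isometry_nonzero[OF isometry[OF qnorm2_unit_letter] v(2)])
  then show "(line_action \<circ> (\<rho> \<circ> unit_letter)) l x \<in> irrational_lines"
    using v by (auto simp: line_action_right_line isometry qnorm2_unit_letter
        intro: irrational_linesI dest: rational_direction_unit_letter)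
  show "(line_action \<circ> (\<rho> \<circ> unit_letter)) (linv l)
      ((line_action \<circ> (\<rho> \<circ> unit_letter)) l x) = x"
    using v nz by (simp add: line_action_right_line isometry qnorm2_unit_letter
        one unit_letter_linv flip: mult)
next
  fix w x assume w: "reduced w" "w \<noteq> []" and "x \<in> irrational_lines"
  then obtain v where v: "x = right_line v" "v \<noteq> 0" "\<not> rational_direction (\<tau> v)"
    by (auto simp: irrational_lines_def)
  define e where "e = prod_list (map unit_letter w)"
  have nz: "\<rho> e v \<noteq> 0"
    unfolding e_def by (rule isometry_nonzero[OF isometry[OF qnorm2_unit_word] v(2)])
  have T: "\<tau> v \<noteq> 0"
  proof
    assume "\<tau> v = 0"
    then show False
      using v(3) unfolding rational_direction_def
      by (metis scaleR_zero_left qint_word_quat)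
  qed
  show "foldr (line_action \<circ> (\<rho> \<circ> unit_letter)) w x \<noteq> x"
  proof
    assume "foldr (line_action \<circ> (\<rho> \<circ> unit_letter)) w x = x"
    then have "right_line (\<rho> e v) = right_line v"
      using v by (simp add: line_action_word e_def)
    \<comment> \<open>Equality of the lines yields a right scalar \<open>c\<close>, which
      \<open>\<tau>\<close> turns into a real factor, while equivariance turns \<open>e\<close> into
      a conjugation.\<close>
    then obtain c where c: "\<rho> e v = v \<cdot>\<^sub>r c"
      using right_line_self[of "\<rho> e v"] by (auto simp: right_line_def)
    then have "c \<noteq> 0"
      using nz by (auto simp: rscale_def vec_eq_iff)
    then obtain r where "\<tau> (v \<cdot>\<^sub>r c) = r *\<^sub>R \<tau> v"
      using scale by blast
    then have "e * \<tau> v * kconj e = r *\<^sub>R \<tau> v"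
      using equivariant[of e v] c by simp
    moreover have "word_quat w = sqrt 5 ^ length w *\<^sub>R e"
      by (simp add: e_def unit_word)
    ultimately have "word_quat w * \<tau> v * kconj (word_quat w) =
        (sqrt 5 ^ length w * sqrt 5 ^ length w * r) *\<^sub>R \<tau> v"
      by (simp flip: mult.assoc)
    from reduced_word_fixed_line[OF w pure T this] show False
      using v(3) by simp
  qed
qed

theorem paradoxical_projective_space:
  "paradoxical (isometry_group :: ('k ^ 'n \<Rightarrow> 'k ^ 'n) monoid)
    projective_space line_action projective_space"
proof -
  let ?G = "isometry_group :: ('k ^ 'n \<Rightarrow> 'k ^ 'n) monoid"
  interpret group_action ?G projective_space line_action
    by (rule group_action_line_action)
  define U where "U = {1, cyclic_turn, irrational_turn, irrational_turn * cyclic_turn}"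
  obtain S where "finite S \<and> S \<subseteq> carrier ?G \<and> (\<forall>v. v \<noteq> 0 \<longrightarrow> (\<exists>s\<in>S. \<tau> (s v) \<noteq> 0))"
    using cover by (elim exE)
  then have S: "finite S" "S \<subseteq> carrier ?G" "\<And>v. v \<noteq> 0 \<Longrightarrow> \<exists>s\<in>S. \<tau> (s v) \<noteq> 0"
    by simp_all
  have U: "qnorm2 u = 1" if "u \<in> U" for u
    using that by (auto simp: U_def qnorm2_mult)
  \<comment> \<open>First \<open>s\<close> makes \<open>\<tau>\<close> nonzero, then the turn
    \<open>u\<close> makes its direction irrational.\<close>
  define C where "C = (\<lambda>(u, s). \<rho> u \<circ> s) ` (U \<times> S)"
  have comp: "\<rho> u \<circ> s \<in> carrier ?G" if "u \<in> U" "s \<in> S" for u s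
    by (rule isometry_comp) (use that isometry U S(2) in auto)
  show ?thesis
  proof (rule paradoxical_if_free_letter_action[OF free_letter_action_lines])
    show "irrational_lines \<subseteq> projective_space"
      by (auto simp: irrational_lines_def projective_space_def)
    have "(\<chi> i. 1) \<noteq> (0 :: 'k ^ 'n)"
      by (simp add: vec_eq_iff)
    then show "projective_space \<noteq> ({} :: ('k ^ 'n) set set)"
      by (auto simp: projective_space_def)
    show "range (\<rho> \<circ> unit_letter) \<subseteq> carrier ?G"
      by (auto intro: isometry qnorm2_unit_letter)
    show "finite C"
      using S(1) by (simp add: C_def U_def)
    show "C \<subseteq> carrier ?G"
      using comp by (auto simp: C_def)
    show "\<forall>x\<in>projective_space. \<exists>g\<in>C. line_action g x \<in> irrational_lines"
    proof
      fix x :: "('k ^ 'n) set" assume "x \<in> projective_space"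
      then obtain v where v: "x = right_line v" "v \<noteq> 0"
        by (auto simp: projective_space_def)
      obtain s where s: "s \<in> S" "\<tau> (s v) \<noteq> 0"
        using S(3) v(2) by blast
      obtain u where u: "u \<in> U" "\<not> rational_direction (u * \<tau> (s v) * kconj u)"
        using ex_turn_irrational[OF pure s(2)] unfolding U_def by blast
      have "line_action (\<rho> u \<circ> s) x = right_line ((\<rho> u \<circ> s) v)"
        using v comp u s by (simp add: line_action_right_line)
      also have "\<dots> \<in> irrational_lines"
        using u s v comp isometry_nonzero[OF comp] equivariant
        by (intro irrational_linesI) auto
      finally show "\<exists>g\<in>C. line_action g x \<in> irrational_lines"
        using u s by (auto simp: C_def)
    qed
  qed
qed

end

section \<open>The three families\<close>

lemma isometry_groupI:
  assumes lin: "right_linear f"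
    and norm: "\<And>v. kre (kinner (f v) (f v)) = kre (kinner v v)"
    and inv: "\<And>v. f (h v) = v" "\<And>v. h (f v) = v"
  shows "f \<in> carrier isometry_group"
proof -
  have "f (x - y) + f y = f x" for x y
    using lin by (metis right_linear_def diff_add_cancel)
  then have "f x - f y = f (x - y)" for x y
    by (metis add_diff_cancel_right')
  moreover have "bij f"
    by (rule bij_betw_byWitness[of _ h]) (use inv in auto)
  ultimately show ?thesis
    using lin norm by (simp add: isometry_group_def kdist_def)
qed

text \<open>The axiom \<open>add_kconj\<close> expresses \<open>kre\<close> through conjugation,
  whose additivity is thus inherited.\<close>

lemma kre_add: "kre (x + y) = kre x + kre (y :: 'k::conj_div_algebra)"
proof -
  have "(2 * kre (x + y)) *\<^sub>R (1::'k) = (2 * kre x) *\<^sub>R 1 + (2 * kre y) *\<^sub>R 1"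
    by (simp only: add_kconj[symmetric] kconj_add) (simp add: algebra_simps)
  then have "(2 * kre (x + y)) *\<^sub>R (1::'k) = (2 * kre x + 2 * kre y) *\<^sub>R 1"
    by (simp only: scaleR_add_left)
  then show ?thesis
    by simp
qed

lemma kre_sum: "kre (sum f S) = (\<Sum>i\<in>S. kre (f i :: 'k::conj_div_algebra))"
proof -
  have "kre (0::'k) = 0"
    using kre_add[of "0::'k" 0] by simp
  then show ?thesis
    by (induction S rule: infinite_finite_induct) (auto simp: kre_add)
qed

lemma kre_kinner: "kre (kinner v v) = (\<Sum>i\<in>UNIV. kre (kconj (v $ i) * v $ i))"
  by (simp add: kinner_def kre_sum)

text \<open>Norm preservation only has to be checked on the set \<open>I\<close> of coordinates that are moved.\<close>

lemma kre_kinner_eqI: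
  fixes v w :: "'k::conj_div_algebra ^ 'n"
  assumes "\<And>i. i \<notin> I \<Longrightarrow> v $ i = w $ i"
    and "(\<Sum>i\<in>I. kre (kconj (v $ i) * v $ i)) = (\<Sum>i\<in>I. kre (kconj (w $ i) * w $ i))"
  shows "kre (kinner v v) = kre (kinner w w)"
proof -
  have "(\<Sum>i\<in>UNIV. kre (kconj (x $ i) * x $ i)) =
      (\<Sum>i\<in>-I. kre (kconj (x $ i) * x $ i)) + (\<Sum>i\<in>I. kre (kconj (x $ i) * x $ i))" for x :: "'k ^ 'n"
    using sum.union_disjoint[of "-I" I] by (simp add: Compl_partition2)
  moreover have "(\<Sum>i\<in>-I. kre (kconj (v $ i) * v $ i)) = (\<Sum>i\<in>-I. kre (kconj (w $ i) * w $ i))"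
    using assms(1) by simp
  ultimately show ?thesis
    using assms(2) by (simp add: kre_kinner)
qed

definition swap_coords :: "'n \<Rightarrow> 'n \<Rightarrow> 'k ^ 'n \<Rightarrow> 'k ^ 'n"
  where "swap_coords a b v = (\<chi> i. v $ Transposition.transpose a b i)"

lemma swap_coords_isometry:
  "(swap_coords a b :: 'k::conj_div_algebra ^ 'n \<Rightarrow> 'k ^ 'n) \<in> carrier isometry_group"
proof (rule isometry_groupI[where h = "swap_coords a b"])
  show "right_linear (swap_coords a b :: 'k ^ 'n \<Rightarrow> 'k ^ 'n)"
    by (simp add: right_linear_def swap_coords_def rscale_def vec_eq_iff)
  fix v :: "'k ^ 'n"
  show "kre (kinner (swap_coords a b v) (swap_coords a b v)) = kre (kinner v v)"
    unfolding kre_kinner swap_coords_def vec_lambda_beta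
    by (rule sum.reindex_bij_betw) (rule bij_transpose)
qed (simp_all add: swap_coords_def vec_eq_iff)

lemma swap_coords_cover:
  fixes a :: "'n::finite"
  shows "\<exists>S. finite S \<and> S \<subseteq> carrier isometry_group \<and>
    (\<forall>v::'k::conj_div_algebra ^ 'n. v \<noteq> 0 \<longrightarrow> (\<exists>s\<in>S. s v $ a \<noteq> 0))"
  by (rule exI[of _ "range (swap_coords a)"])
    (auto simp: swap_coords_isometry swap_coords_def vec_eq_iff)

subsection \<open>Real projective spaces\<close>

locale real_coords =
  fixes a b c :: "'n::finite"
  assumes distinct: "a \<noteq> b" "a \<noteq> c" "b \<noteq> c"
begin

definition direction :: "real ^ 'n \<Rightarrow> quat"
  where "direction v = Quat 0 (v $ a) (v $ b) (v $ c)"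

definition rotation :: "quat \<Rightarrow> real ^ 'n \<Rightarrow> real ^ 'n"
  where "rotation u v = (let p = u * direction v * kconj u in
    \<chi> i. if i = a then qi p else if i = b then qj p else if i = c then qk p else v $ i)"

lemma direction_rotation: "direction (rotation u v) = u * direction v * kconj u"
proof -
  \<comment> \<open>Conjugation keeps pure quaternions pure, so storing only three coordinates loses
    nothing.\<close>
  have "qre (u * direction v * kconj u) = 0"
    by (simp add: direction_def quat_sel_times algebra_simps)
  then show ?thesis
    using distinct by (simp add: direction_def[of "vec_lambda f" for f] rotation_def Let_def quat_eq_iff)
qed

lemma rotation_mult: "rotation (u * w) v = rotation u (rotation w v)"
  unfolding rotation_def[of "u * w"] rotation_def[of u] direction_rotation
  by (simp add: Let_def vec_eq_iff kconj_mult mult.assoc) (simp add: rotation_def Let_def)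

lemma rotation_one: "rotation 1 v = v"
  by (simp add: rotation_def Let_def vec_eq_iff direction_def kconj_mult_quat[of 1, simplified])

lemma rotation_isometry:
  assumes "qnorm2 u = 1"
  shows "rotation u \<in> carrier isometry_group"
proof (rule isometry_groupI[where h = "rotation (kconj u)"])
  show "right_linear (rotation u)"
    by (simp add: right_linear_def rotation_def direction_def rscale_def vec_eq_iff Let_def
        quat_sel_times algebra_simps)
  fix v :: "real ^ 'n"
  have n: "(\<Sum>i\<in>{a, b, c}. kre (kconj (w $ i) * w $ i)) = qnorm2 (direction w)" for w
    using distinct by (simp add: qnorm2_def direction_def kconj_real_def kre_real_def
        power2_eq_square)
  show "kre (kinner (rotation u v) (rotation u v)) = kre (kinner v v)"
    by (rule kre_kinner_eqI[of "{a, b, c}"])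
      (simp add: rotation_def Let_def, simp only: n direction_rotation qnorm2_mult assms
        qnorm2_kconj mult_1 mult_1_right)
qed (simp_all add: rotation_one kconj_mult_quat mult_kconj_quat assms flip: rotation_mult)

sublocale quat_rotation_action rotation direction
proof
  fix v :: "real ^ 'n" and k :: real assume "k \<noteq> 0"
  then show "\<exists>r. r \<noteq> 0 \<and> direction (v \<cdot>\<^sub>r k) = r *\<^sub>R direction v"
    by (intro exI[of _ k]) (simp add: direction_def rscale_def quat_eq_iff)
next
  obtain S :: "(real ^ 'n \<Rightarrow> real ^ 'n) set"
    where "finite S" "S \<subseteq> carrier isometry_group" "\<And>v. v \<noteq> 0 \<Longrightarrow> \<exists>s\<in>S. s v $ a \<noteq> 0"
    using swap_coords_cover by metis
  then show "\<exists>S. finite S \<and> S \<subseteq> carrier isometry_group \<and>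
      (\<forall>v. v \<noteq> 0 \<longrightarrow> (\<exists>s\<in>S. direction (s v) \<noteq> 0))"
    by (intro exI[of _ S]) (force simp: direction_def quat_eq_iff)
qed (simp_all add: rotation_isometry rotation_mult rotation_one direction_rotation,
    simp add: direction_def)

end

subsection \<open>Complex projective spaces\<close>

text \<open>
  \<open>\<complex>\<^sup>2\<close> is identified with the quaternions as a right complex vector space by
  \<open>(z, w) \<mapsto> z + j w\<close>; then \<open>q \<mapsto> q i q\<^sup>*\<close> is the Hopf map.
\<close>

locale complex_coords =
  fixes a b :: "'n::finite"
  assumes distinct: "a \<noteq> b"
begin

text \<open>The sign in the last coordinate comes from \<open>j * i = - k\<close>.\<close>

definition quat_part :: "complex ^ 'n \<Rightarrow> quat"
  where "quat_part v = Quat (Re (v $ a)) (Im (v $ a)) (Re (v $ b)) (- Im (v $ b))"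

definition direction :: "complex ^ 'n \<Rightarrow> quat"
  where "direction v = quat_part v * Quat 0 1 0 0 * kconj (quat_part v)"

definition rotation :: "quat \<Rightarrow> complex ^ 'n \<Rightarrow> complex ^ 'n"
  where "rotation u v = (let p = u * quat_part v in
    \<chi> i. if i = a then Complex (qre p) (qi p)
      else if i = b then Complex (qj p) (- qk p) else v $ i)"

lemma quat_part_rotation: "quat_part (rotation u v) = u * quat_part v"
  using distinct by (simp add: quat_part_def[of "vec_lambda f" for f] rotation_def Let_def quat_eq_iff)

lemma quat_part_scale:
  "quat_part (v \<cdot>\<^sub>r k) = quat_part v * Quat (Re k) (Im k) 0 0"
  by (simp add: quat_part_def rscale_def quat_eq_iff quat_sel_times algebra_simps)

lemma rotation_mult: "rotation (u * w) v = rotation u (rotation w v)"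
  unfolding rotation_def[of "u * w"] rotation_def[of u] quat_part_rotation
  by (simp add: Let_def vec_eq_iff mult.assoc) (simp add: rotation_def Let_def)

lemma rotation_one: "rotation 1 v = v"
  by (simp add: rotation_def Let_def vec_eq_iff quat_part_def complex_eq_iff)

lemma rotation_isometry:
  assumes "qnorm2 u = 1"
  shows "rotation u \<in> carrier isometry_group"
proof (rule isometry_groupI[where h = "rotation (kconj u)"])
  show "right_linear (rotation u)"
    by (simp add: right_linear_def rotation_def quat_part_def rscale_def vec_eq_iff Let_def
        quat_sel_times complex_eq_iff algebra_simps)
  fix v :: "complex ^ 'n"
  have n: "(\<Sum>i\<in>{a, b}. kre (kconj (w $ i) * w $ i)) = qnorm2 (quat_part w)" for w
    using distinct by (simp add: qnorm2_def quat_part_def kconj_complex_def kre_complex_def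
        power2_eq_square)
  show "kre (kinner (rotation u v) (rotation u v)) = kre (kinner v v)"
    by (rule kre_kinner_eqI[of "{a, b}"])
      (simp add: rotation_def Let_def, simp only: n quat_part_rotation qnorm2_mult assms mult_1)
qed (simp_all add: rotation_one kconj_mult_quat mult_kconj_quat assms flip: rotation_mult)

sublocale quat_rotation_action rotation direction
proof
  fix u and v :: "complex ^ 'n"
  show "direction (rotation u v) = u * direction v * kconj u"
    by (simp add: direction_def quat_part_rotation kconj_mult mult.assoc)
next
  fix v :: "complex ^ 'n" and k :: complex assume "k \<noteq> 0"
  then have "(Re k)\<^sup>2 + (Im k)\<^sup>2 \<noteq> 0"
    by (simp add: complex_eq_iff sum_power2_eq_zero_iff)
  \<comment> \<open>A complex scalar commutes with \<open>i\<close>, so it multiplies the Hopf map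
    by its squared modulus.\<close>
  then show "\<exists>r. r \<noteq> 0 \<and> direction (v \<cdot>\<^sub>r k) = r *\<^sub>R direction v"
    by (intro exI[of _ "(Re k)\<^sup>2 + (Im k)\<^sup>2"])
      (simp add: direction_def quat_part_scale quat_eq_iff quat_sel_times power2_eq_square
        algebra_simps)
next
  obtain S :: "(complex ^ 'n \<Rightarrow> complex ^ 'n) set"
    where S: "finite S" "S \<subseteq> carrier isometry_group" "\<And>v. v \<noteq> 0 \<Longrightarrow> \<exists>s\<in>S. s v $ a \<noteq> 0"
    using swap_coords_cover by metis
  moreover have "direction v \<noteq> 0" if "v $ a \<noteq> 0" for v
  proof -
    have "quat_part v \<noteq> 0"
      using that by (auto simp: quat_part_def quat_eq_iff complex_eq_iff)
    moreover have "Quat 0 1 0 0 \<noteq> 0" "kconj x \<noteq> 0 \<longleftrightarrow> x \<noteq> 0" for x :: quat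
      by (simp_all add: quat_eq_iff)
    ultimately show ?thesis
      by (simp add: direction_def)
  qed
  ultimately show "\<exists>S. finite S \<and> S \<subseteq> carrier isometry_group \<and>
      (\<forall>v. v \<noteq> 0 \<longrightarrow> (\<exists>s\<in>S. direction (s v) \<noteq> 0))"
    by (intro exI[of _ S]) blast
qed (simp_all add: rotation_isometry rotation_mult rotation_one,
    simp add: direction_def quat_sel_times algebra_simps)

end

subsection \<open>Quaternionic projective spaces\<close>

locale quat_coords =
  fixes a b :: "'n::finite"
  assumes distinct: "a \<noteq> b"
begin

text \<open>In \<open>v $ b * kconj (v $ a)\<close> a right scalar \<open>k\<close> contributes only
  the real factor \<open>qnorm2 k\<close>, while a left factor \<open>u\<close> acts by
  conjugation.\<close>

definition direction :: "quat ^ 'n \<Rightarrow> quat"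
  where "direction v = (let p = v $ b * kconj (v $ a) in p - qre p *\<^sub>R 1)"

definition rotation :: "quat \<Rightarrow> quat ^ 'n \<Rightarrow> quat ^ 'n"
  where "rotation u v = (\<chi> i. u * v $ i)"

abbreviation iq :: quat
  where "iq \<equiv> Quat 0 1 0 0"

definition twist :: "quat \<Rightarrow> quat ^ 'n \<Rightarrow> quat ^ 'n"
  where "twist u v = (\<chi> i. if i = b then u * v $ b else v $ i)"

definition mix :: "quat \<Rightarrow> quat ^ 'n \<Rightarrow> quat ^ 'n"
  where "mix u v = (\<chi> i. if i = a then (1 / sqrt 2) *\<^sub>R (v $ a + u * v $ b)
    else if i = b then (1 / sqrt 2) *\<^sub>R (u * v $ a + v $ b) else v $ i)"

lemma kre_kconj_mult_quat: "kre (kconj x * x) = qnorm2 x"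
  by (simp add: kconj_mult_quat kre_quat_def)

lemma rotation_isometry:
  assumes "qnorm2 u = 1"
  shows "rotation u \<in> carrier isometry_group"
proof (rule isometry_groupI[where h = "rotation (kconj u)"])
  fix v :: "quat ^ 'n"
  show "kre (kinner (rotation u v) (rotation u v)) = kre (kinner v v)"
    by (simp add: kre_kinner kre_kconj_mult_quat rotation_def qnorm2_mult assms)
qed (simp_all add: right_linear_def rotation_def rscale_def vec_eq_iff distrib_left mult.assoc
    kconj_mult_quat mult_kconj_quat assms flip: mult.assoc)

lemma twist_isometry:
  assumes "qnorm2 u = 1"
  shows "twist u \<in> carrier isometry_group"
proof (rule isometry_groupI[where h = "twist (kconj u)"])
  fix v :: "quat ^ 'n"
  show "kre (kinner (twist u v) (twist u v)) = kre (kinner v v)"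
    by (rule kre_kinner_eqI[of "{b}"])
      (simp_all add: kre_kconj_mult_quat twist_def qnorm2_mult assms)
qed (simp_all add: right_linear_def twist_def rscale_def vec_eq_iff distrib_left
    kconj_mult_quat mult_kconj_quat assms flip: mult.assoc)

text \<open>The entries \<open>1\<close>, \<open>i\<close>, \<open>i\<close>, \<open>1\<close>
  divided by \<open>sqrt 2\<close> form a unitary matrix; its inverse has \<open>- i\<close> in
  place of \<open>i\<close>.\<close>

lemma mix_isometry: "mix iq \<in> carrier isometry_group"
proof (rule isometry_groupI[where h = "mix (- iq)"])
  have i: "- iq = Quat 0 (-1) 0 0"
    by (simp add: uminus_quat_def)
  show "right_linear (mix iq)"
    by (simp add: right_linear_def mix_def rscale_def vec_eq_iff algebra_simps)
  fix v :: "quat ^ 'n"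
  show "kre (kinner (mix iq v) (mix iq v)) = kre (kinner v v)"
    by (rule kre_kinner_eqI[of "{a, b}"])
      (use distinct in \<open>simp_all add: kre_kconj_mult_quat mix_def qnorm2_scaleR power_divide\<close>,
       simp add: qnorm2_def quat_sel_times power2_eq_square field_simps)
  show "mix iq (mix (- iq) v) = v" "mix (- iq) (mix iq v) = v"
    unfolding i using distinct
    by (simp_all add: mix_def vec_eq_iff quat_eq_iff quat_sel_times flip: add_divide_distrib)
qed

text \<open>
  If \<open>v\<^sub>a \<noteq> 0\<close> and \<open>v\<^sub>b v\<^sub>a\<^sup>*\<close> is real, then one of \<open>twist iq\<close> (for \<open>v\<^sub>b \<noteq> 0\<close>) and \<open>mix iq\<close>
  (for \<open>v\<^sub>b = 0\<close>) makes this product non-real.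
\<close>

lemma direction_nonzero:
  assumes "v $ a \<noteq> 0"
  shows "\<exists>f\<in>{id, twist iq, mix iq}. direction (f v) \<noteq> 0"
proof (cases "v $ b = 0")
  case True
  have "qnorm2 (v $ a) > 0"
    using qnorm2_pos assms by (simp add: zero_quat_def)
  \<comment> \<open>After mixing, the product in \<open>direction\<close> is \<open>iq\<close> times
    the positive real \<open>qnorm2 (v $ a) / 2\<close>.\<close>
  then have "qi (direction (mix iq v)) \<noteq> 0"
    using True distinct
    by (simp add: direction_def mix_def Let_def quat_sel_times qnorm2_def power2_eq_square)
  then show ?thesis
    by auto
next
  case False
  define p where "p = v $ b * kconj (v $ a)"
  have "kconj (v $ a) \<noteq> 0"
    using assms by (simp add: quat_eq_iff)
  then have "p \<noteq> 0"
    using False by (simp add: p_def)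
  have "direction (twist iq v) = iq * p - qre (iq * p) *\<^sub>R 1"
    using distinct by (simp add: direction_def twist_def p_def Let_def mult.assoc)
  moreover have "direction v = p - qre p *\<^sub>R 1"
    by (simp add: direction_def p_def Let_def)
  \<comment> \<open>If \<open>p\<close> is real and nonzero, then \<open>iq * p\<close> is not
    real.\<close>
  ultimately have "direction v \<noteq> 0 \<or> direction (twist iq v) \<noteq> 0"
    using \<open>p \<noteq> 0\<close> by (auto simp: quat_eq_iff quat_sel_times)
  then show ?thesis
    by auto
qed

sublocale quat_rotation_action rotation direction
proof
  fix u and v :: "quat ^ 'n"
  \<comment> \<open>Conjugation by \<open>u\<close> scales the real part by \<open>qnorm2 u\<close>,
    so it commutes with taking the imaginary part.\<close>
  have "qre (u * (p * kconj u)) = qnorm2 u * qre p" for p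
    by (simp add: quat_sel_times qnorm2_def power2_eq_square algebra_simps)
  from this[of "v $ b * kconj (v $ a)"] show "direction (rotation u v) = u * direction v * kconj u"
    by (simp add: direction_def rotation_def Let_def kconj_mult algebra_simps mult_kconj_quat)
next
  fix v :: "quat ^ 'n" and k :: quat assume "k \<noteq> 0"
  then have "qnorm2 k \<noteq> 0"
    using qnorm2_pos[of k] by (simp add: zero_quat_def)
  moreover have "v $ b * k * kconj (v $ a * k) = qnorm2 k *\<^sub>R (v $ b * kconj (v $ a))"
  proof -
    have "v $ b * k * kconj (v $ a * k) = v $ b * (k * kconj k) * kconj (v $ a)"
      by (simp add: kconj_mult mult.assoc)
    then show ?thesis
      by (simp add: mult_kconj_quat)
  qed
  ultimately show "\<exists>r. r \<noteq> 0 \<and> direction (v \<cdot>\<^sub>r k) = r *\<^sub>R direction v"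
    by (intro exI[of _ "qnorm2 k"])
      (simp add: direction_def rscale_def Let_def scaleR_diff_right)
next
  obtain S :: "(quat ^ 'n \<Rightarrow> quat ^ 'n) set"
    where S: "finite S" "S \<subseteq> carrier isometry_group" "\<And>v. v \<noteq> 0 \<Longrightarrow> \<exists>s\<in>S. s v $ a \<noteq> 0"
    using swap_coords_cover by metis
  define F where "F = {id, twist iq, mix iq}"
  have "qnorm2 iq = 1"
    by (simp add: qnorm2_def)
  then have F: "F \<subseteq> carrier isometry_group"
    using twist_isometry mix_isometry
    by (auto simp: F_def) (simp add: isometry_group_def right_linear_def)
  show "\<exists>S. finite S \<and> S \<subseteq> carrier isometry_group \<and>
      (\<forall>v. v \<noteq> 0 \<longrightarrow> (\<exists>s\<in>S. direction (s v) \<noteq> 0))"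
  proof (intro exI[of _ "(\<lambda>(f, s). f \<circ> s) ` (F \<times> S)"] conjI allI impI)
    show "(\<lambda>(f, s). f \<circ> s) ` (F \<times> S) \<subseteq> carrier isometry_group"
      using F S(2) by (auto intro!: isometry_comp)
    fix v :: "quat ^ 'n" assume "v \<noteq> 0"
    then obtain s where s: "s \<in> S" "s v $ a \<noteq> 0"
      using S(3) by blast
    then obtain f where "f \<in> F" "direction (f (s v)) \<noteq> 0"
      using direction_nonzero[OF s(2)] unfolding F_def by blast
    then show "\<exists>g\<in>(\<lambda>(f, s). f \<circ> s) ` (F \<times> S). direction (g v) \<noteq> 0"
      using s by force
  qed (use S in \<open>simp add: F_def\<close>)
qed (simp_all add: rotation_isometry, simp_all add: rotation_def direction_def Let_def mult.assoc)

end

lemma ex_two_distinct: "2 \<le> CARD('n::finite) \<Longrightarrow> \<exists>a b :: 'n. a \<noteq> b"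
  using card_le_Suc0_iff_eq[of "UNIV :: 'n set"] by fastforce

theorem theorem4:
  shows "(3 \<le> CARD('n::finite) \<longrightarrow>
      paradoxical (isometry_group :: (real ^ 'n \<Rightarrow> real ^ 'n) monoid)
        projective_space line_action projective_space) \<and>
    (2 \<le> CARD('n) \<longrightarrow>
      paradoxical (isometry_group :: (complex ^ 'n \<Rightarrow> complex ^ 'n) monoid)
        projective_space line_action projective_space) \<and>
    (2 \<le> CARD('n) \<longrightarrow>
      paradoxical (isometry_group :: (quat ^ 'n \<Rightarrow> quat ^ 'n) monoid)
        projective_space line_action projective_space)"
proof (intro conjI impI)
  assume "3 \<le> CARD('n)"
  then obtain T :: "'n set" where "card T = 3"
    using obtain_subset_with_card_n by metis
  then obtain a b c :: 'n where "a \<noteq> b" "a \<noteq> c" "b \<noteq> c"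
    by (auto simp: card_3_iff)
  then interpret real_coords a b c
    by unfold_locales
  show "paradoxical (isometry_group :: (real ^ 'n \<Rightarrow> real ^ 'n) monoid)
      projective_space line_action projective_space"
    by (rule paradoxical_projective_space)
next
  assume "2 \<le> CARD('n)"
  then obtain a b :: 'n where "a \<noteq> b"
    using ex_two_distinct by metis
  then interpret complex_coords a b
    by unfold_locales
  show "paradoxical (isometry_group :: (complex ^ 'n \<Rightarrow> complex ^ 'n) monoid)
      projective_space line_action projective_space"
    by (rule paradoxical_projective_space)
next
  assume "2 \<le> CARD('n)"
  then obtain a b :: 'n where "a \<noteq> b"
    using ex_two_distinct by metis
  then interpret quat_coords a b
    by unfold_locales
  show "paradoxical (isometry_group :: (quat ^ 'n \<Rightarrow> quat ^ 'n) monoid)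
      projective_space line_action projective_space"
    by (rule paradoxical_projective_space)
qed

end
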